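(* Let $f$ be a penalty of max-linear form (see context), let $f_n=n^{1/2}f$, let $\hat\beta_n$ be the minimizer over $\beta\in\mathbb{R}^p$ of $\frac12\Vert y-X\beta\Vert_2^2+f_n(\beta)$ in the linear model described in the context with $C$ positive definite, and let $\hat u_n=\sqrt n(\hat\beta_n-\beta^0)$. Let $\hat u$ be the minimizer of $V(u)=\frac12u^TCu-u^TW+f'(\beta^0;u)$, where $W\sim\mathcal N(0,\sigma^2C)$. Then for every convex set $\mathcal K\subset\mathbb{R}^p$, $$\mathbb P[\hat u_n\in\mathcal K]\longrightarrow\mathbb P[\hat u\in\mathcal K]\quad\text{as }n\to\infty.$$ In particular, $\hat u_n$ converges weakly in pattern to $\hat u$: for every pattern $\mathfrak p\in\mathfrak P$, $$\mathbb P[I(\hat u_n)=\mathfrak p]\longrightarrow\mathbb P[I(\hat u)=\mathfrak p]\quad\text{as }n\to\infty,$$ where $I$ is the pattern function, and $\mathfrak P$ the set of patterns, of any penalty of max-linear form (not necessarily the penalty $f$ defining $\hat u_n$).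
   Context: Linear model: $p$ is fixed and $\beta^0\in\mathbb{R}^p$ is a fixed vector. For each $n$, $y=X\beta^0+\varepsilon$ with $X=(X_1,\dots,X_n)^T\in\mathbb{R}^{n\times p}$ and $\varepsilon=(\varepsilon_1,\dots,\varepsilon_n)^T$, where $X_1,X_2,\dots$ are i.i.d. centered random vectors in $\mathbb{R}^p$ with covariance matrix $C$, $\varepsilon_1,\varepsilon_2,\dots$ are i.i.d. centered random variables with variance $\sigma^2>0$, and the sequences $(X_i)$ and $(\varepsilon_i)$ are independent. Convention: $\hat\beta_n$ is a random vector which is a minimizer of the stated objective whenever one exists. Max-linear form: a function $f:\mathbb{R}^p\to\mathbb{R}$ is a penalty of max-linear form if $f(x)=\max\{\langle v_i,x\rangle:i\in\mathcal S\}+g(x)$, where $\mathcal S$ is a finite index set, $g:\mathbb{R}^p\to\mathbb{R}$ is convex and continuously differentiable, and $v_i$ ($i\in\mathcal S$) are distinct vectors in $\mathbb{R}^p$ such that $v_i$ is not in the convex hull of $\{v_j:j\neq i\}$ for every $i\in\mathcal S$. Pattern: the pattern of such an $f$ at $x$ is the index set $I(x)=I_f(x)=\operatorname{argmax}_{i\in\mathcal S}\langle v_i,x\rangle\subset\mathcal S$, and the set of patterns is $\mathfrak P=\mathfrak P_f=\{I(x):x\in\mathbb{R}^p\}$. Directional derivative: $f'(x;u)=\lim_{t\downarrow0}\frac{f(x+tu)-f(x)}{t}$. *)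

theory Defs
  imports "HOL-Probability.Probability"
begin

text \<open>
  Penalties of max-linear form.  The family \<open>v\<close> indexed by the finite set \<open>S\<close> and the smooth
  part \<open>g\<close> are explicit parameters, because patterns are sets of indices.
\<close>

definition max_linear_form ::
  "(real^'p \<Rightarrow> real) \<Rightarrow> 'i set \<Rightarrow> ('i \<Rightarrow> real^'p) \<Rightarrow> (real^'p \<Rightarrow> real) \<Rightarrow> bool" where
  "max_linear_form f S v g \<longleftrightarrow>
     finite S \<and> S \<noteq> {} \<and>
     inj_on v S \<and> (\<forall>i\<in>S. v i \<notin> convex hull (v ` (S - {i}))) \<and>
     convex_on UNIV g \<and>
     (\<exists>G. (\<forall>x. GDERIV g x :> G x) \<and> continuous_on UNIV G) \<and>
     (\<forall>x. f x = Max ((\<lambda>i. v i \<bullet> x) ` S) + g x)"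

definition pattern :: "'i set \<Rightarrow> ('i \<Rightarrow> real^'p) \<Rightarrow> real^'p \<Rightarrow> 'i set" where
  "pattern S v x = {i. is_arg_max (\<lambda>i. v i \<bullet> x) (\<lambda>i. i \<in> S) i}"

definition patterns :: "'i set \<Rightarrow> ('i \<Rightarrow> real^'p) \<Rightarrow> 'i set set" where
  "patterns S v = range (pattern S v)"

definition dir_deriv :: "('a::real_vector \<Rightarrow> real) \<Rightarrow> 'a \<Rightarrow> 'a \<Rightarrow> real" where
  "dir_deriv f x u = Lim (at_right 0) (\<lambda>t. (f (x + t *\<^sub>R u) - f x) / t)"

definition positive_definite :: "real^'p^'p \<Rightarrow> bool" where
  "positive_definite A \<longleftrightarrow> transpose A = A \<and> (\<forall>x. x \<noteq> 0 \<longrightarrow> x \<bullet> (A *v x) > 0)"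

definition covariance_matrix :: "'a measure \<Rightarrow> ('a \<Rightarrow> real^'p) \<Rightarrow> real^'p^'p" where
  "covariance_matrix M X =
     (\<chi> j k. \<integral>\<omega>. (X \<omega> $ j - (\<integral>\<omega>'. X \<omega>' $ j \<partial>M)) * (X \<omega> $ k - (\<integral>\<omega>'. X \<omega>' $ k \<partial>M)) \<partial>M)"

text \<open>
  Lebesgue density of the normal distribution with mean \<open>\<mu>\<close> and covariance matrix \<open>\<Sigma>\<close>;
  meaningful only for positive definite \<open>\<Sigma>\<close>.
\<close>

definition mvnormal_density :: "real^'p \<Rightarrow> real^'p^'p \<Rightarrow> real^'p \<Rightarrow> real" where
  "mvnormal_density \<mu> \<Sigma> x =
     exp (- ((x - \<mu>) \<bullet> (matrix_inv \<Sigma> *v (x - \<mu>))) / 2) / sqrt ((2 * pi) ^ CARD('p) * det \<Sigma>)"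

text \<open>
  Random design and noise.  Observations are numbered from \<open>0\<close>, so the sample of size \<open>n\<close>
  consists of those with index \<open>i < n\<close>.  Square integrability is explicit, since the Bochner
  integral of a non-integrable function is \<open>0\<close>.  The last assumption is the independence of the
  two sequences: \<open>indep_var\<close> would need them to have the same type, so the generated sigma
  algebras are used.
\<close>

locale linear_model = prob_space M
  for M :: "'a measure"
  and X :: "nat \<Rightarrow> 'a \<Rightarrow> real^'p"
  and \<epsilon> :: "nat \<Rightarrow> 'a \<Rightarrow> real"
  and C :: "real^'p^'p"
  and \<sigma> :: real +
  assumes X_indep: "indep_vars (\<lambda>_. borel) X UNIV"
    and X_ident: "\<And>i j. distr M borel (X i) = distr M borel (X j)"
    and X_square_integrable: "\<And>i. integrable M (\<lambda>\<omega>. (norm (X i \<omega>))\<^sup>2)"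
    and X_centered: "\<And>i. expectation (X i) = 0"
    and X_covariance: "\<And>i. covariance_matrix M (X i) = C"
    and \<epsilon>_indep: "indep_vars (\<lambda>_. borel) \<epsilon> UNIV"
    and \<epsilon>_ident: "\<And>i j. distr M borel (\<epsilon> i) = distr M borel (\<epsilon> j)"
    and \<epsilon>_square_integrable: "\<And>i. integrable M (\<lambda>\<omega>. (\<epsilon> i \<omega>)\<^sup>2)"
    and \<epsilon>_centered: "\<And>i. expectation (\<epsilon> i) = 0"
    and \<epsilon>_variance: "\<And>i. variance (\<epsilon> i) = \<sigma>\<^sup>2"
    and \<sigma>_pos: "\<sigma>\<^sup>2 > 0"
    and X_\<epsilon>_indep:
      "indep_set (sets (vimage_algebra (space M) (\<lambda>\<omega> i. X i \<omega>) (Pi\<^sub>M UNIV (\<lambda>_. borel))))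
                 (sets (vimage_algebra (space M) (\<lambda>\<omega> i. \<epsilon> i \<omega>) (Pi\<^sub>M UNIV (\<lambda>_. borel))))"

text \<open>
  Penalized least squares objective for the design matrix with rows \<open>x i\<close> and the response
  \<open>y i\<close>, \<open>i < n\<close>; \<open>L2_set\<close> is the Euclidean norm of the residual vector in dimension \<open>n\<close>.
\<close>

definition penalized_ls ::
  "nat \<Rightarrow> (nat \<Rightarrow> real) \<Rightarrow> (nat \<Rightarrow> real^'p) \<Rightarrow> (real^'p \<Rightarrow> real) \<Rightarrow> real^'p \<Rightarrow> real" where
  "penalized_ls n y x h b = (L2_set (\<lambda>i. y i - x i \<bullet> b) {..<n})\<^sup>2 / 2 + h b"

end

theory Submission
  imports Defs
begin

text \<open>
  The rescaled minimizer is stationary, with probability tending to one, for the limit objective with a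
  perturbed noise: \<open>w' \<in> C u + \<nabla>g(\<beta>0) + conv {v i | i active at u}\<close>, where \<open>w'\<close> differs from the score
  \<open>X\<^sup>T \<epsilon> / \<surd>n\<close> by a term that vanishes in probability; the minimizer \<open>U\<close> satisfies the same inclusion with
  noise \<open>W\<close>.  The inclusion determines \<open>u\<close>, and the set of noise vectors whose solution lies in a convex
  set \<open>K\<close> is a finite union of convex sets, one for each pattern.  Its frontier is therefore a Lebesgue null
  set, even when \<open>K\<close> is lower-dimensional and charged by the law of \<open>U\<close>, and the claim follows from
  the multivariate central limit theorem for the score, applied to the interior of that set and to the
  complement of its closure.  Patterns are covered because their cells are convex.
\<close>

section \<open>Gaussian smoothing and characteristic functions\<close>

text \<open>Weak convergence of the rescaled minimizers alone would say nothing about a thin cell.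
  Noise space helps because the hull attached to a cell spans exactly the directions that the cell
  lacks. The passage to noise space is possible since patterns near \<beta>0 are exact and not
  merely asymptotic: for small \<open>z\<close> the indices active at \<beta>0 + z are those maximal
  for \<open>z\<close> among the indices active at \<beta>0, and scaling \<open>z\<close> by a
  positive factor does not change them. Hence only the Gram matrix and the gradient of
  \<open>g\<close> are approximated, and both errors can be moved into the noise. The complement of
  a convex \<open>K\<close> is not convex, so the lower bound for the probabilities is stated for an
  arbitrary \<open>K\<close> and an open set of noise vectors; using it for \<open>K\<close> and for
  its complement gives both halves of the limit. The score is vector-valued: its characteristic
  function is found along each direction by the scalar central limit theorem, and smoothing recovers
  probabilities of open sets from it.\<close>

definition gauss_density :: "'a::euclidean_space \<Rightarrow> real" where
  "gauss_density x = (\<Prod>b\<in>Basis. std_normal_density (x \<bullet> b))"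

definition std_gauss :: "'a::euclidean_space measure" where
  "std_gauss = density lborel gauss_density"

lemma gauss_density_nonneg [simp]: "0 \<le> gauss_density x"
  by (simp add: gauss_density_def prod_nonneg)

lemma gauss_density_measurable [measurable]: "gauss_density \<in> borel_measurable borel"
  unfolding gauss_density_def by measurable

lemma norm_square_Basis: "(norm (x::'a::euclidean_space))\<^sup>2 = (\<Sum>b\<in>Basis. (x \<bullet> b)\<^sup>2)"
  unfolding power2_norm_eq_inner by (subst euclidean_inner) (simp add: power2_eq_square)

lemma gauss_density_eq:
  "gauss_density (x::'a::euclidean_space) = exp (- (norm x)\<^sup>2 / 2) / sqrt (2 * pi) ^ DIM('a)"
proof -
  have "exp (- (norm x)\<^sup>2 / 2) = (\<Prod>b\<in>Basis. exp (- (x \<bullet> b)\<^sup>2 / 2))"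
    by (simp add: norm_square_Basis[of x] exp_sum[symmetric] sum_negf sum_divide_distrib)
  then show ?thesis
    by (simp add: gauss_density_def std_normal_density_def prod_dividef)
qed

lemma sets_std_gauss [simp, measurable_cong]: "sets std_gauss = sets borel"
  and space_std_gauss [simp]: "space std_gauss = UNIV"
  by (simp_all add: std_gauss_def)

lemma prob_space_std_gauss: "prob_space (std_gauss :: 'a::euclidean_space measure)"
proof
  have "emeasure std_gauss (space (std_gauss :: 'a measure))
      = (\<integral>\<^sup>+x. (\<Prod>b\<in>Basis. std_normal_density ((x::'a) \<bullet> b)) \<partial>lborel)"
    by (simp add: std_gauss_def emeasure_density gauss_density_def)
  also have "\<dots> = (\<integral>\<^sup>+x. (\<Prod>b\<in>Basis. ennreal (std_normal_density ((x::'a) \<bullet> b))) \<partial>lborel)"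
    by (simp add: prod_ennreal)
  also have "\<dots> = (\<Prod>b\<in>(Basis::'a set). (\<integral>\<^sup>+x. std_normal_density x \<partial>lborel))"
    by (subst nn_integral_lborel_prod[symmetric]) (auto)
  also have "\<dots> = 1"
    using prob_space.emeasure_space_1[OF prob_space_normal_density[of 1 0]]
    by (simp add: emeasure_density)
  finally show "emeasure std_gauss (space (std_gauss :: 'a measure)) = 1" .
qed

text \<open>Density and character both factor over the coordinates, so Fubini on the product measure
  reduces the integral to the one-dimensional characteristic function.\<close>

lemma char_std_gauss:
  "(CLINT x|std_gauss. iexp ((t::'a::euclidean_space) \<bullet> x)) = exp (- (norm t)\<^sup>2 / 2)"
proof -
  interpret product_sigma_finite "\<lambda>_::'a. lborel :: real measure"
    by standard
  define h where "h b s = std_normal_density s *\<^sub>R iexp ((t \<bullet> b) * s)" for b s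
  have int: "integrable lborel (h b)" for b
    unfolding h_def
    by (rule Bochner_Integration.integrable_bound[OF integrable_normal_density[of 1 0]]) auto
  have val: "integral\<^sup>L lborel (h b) = exp (- (t \<bullet> b)\<^sup>2 / 2)" for b
  proof -
    have "integral\<^sup>L lborel (h b) = char std_normal_distribution (t \<bullet> b)"
      unfolding char_def h_def by (subst integral_density) auto
    then show ?thesis by (simp add: char_std_normal_distribution)
  qed
  have prod_eq: "gauss_density x *\<^sub>R iexp (t \<bullet> x) = (\<Prod>b\<in>Basis. h b (x \<bullet> b))" for x
  proof -
    have "iexp (t \<bullet> x) = (\<Prod>b\<in>Basis. iexp ((t \<bullet> b) * (x \<bullet> b)))"
      by (subst euclidean_inner) (simp add: exp_sum[symmetric] sum_distrib_left)
    then show ?thesis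
      by (simp add: h_def gauss_density_def scaleR_conv_of_real prod.distrib)
  qed
  have meas: "(\<lambda>x. \<Prod>b\<in>Basis. h b (x \<bullet> b)) \<in> borel_measurable borel"
    unfolding h_def by measurable
  have "(CLINT x|std_gauss. iexp (t \<bullet> x)) = (CLINT x|lborel. gauss_density x *\<^sub>R iexp (t \<bullet> x))"
    unfolding std_gauss_def by (subst integral_density) auto
  also have "\<dots> = (CLINT x|distr (\<Pi>\<^sub>M b\<in>Basis. lborel) borel (\<lambda>f. \<Sum>b\<in>Basis. f b *\<^sub>R b).
       gauss_density x *\<^sub>R iexp (t \<bullet> x))"
    by (subst lborel_eq) simp
  also have "\<dots> = (CLINT f|(\<Pi>\<^sub>M b\<in>Basis. lborel). \<Prod>b\<in>Basis. h b (f b))"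
    using meas by (subst integral_distr) (auto simp: prod_eq inner_sum_left inner_Basis if_distrib sum.delta
        cong: if_cong intro!: Bochner_Integration.integral_cong prod.cong)
  also have "\<dots> = (\<Prod>b\<in>Basis. complex_of_real (exp (- (t \<bullet> b)\<^sup>2 / 2)))"
    by (subst product_integral_prod) (auto simp: int val)
  also have "\<dots> = complex_of_real (\<Prod>b\<in>Basis. exp (- (t \<bullet> b)\<^sup>2 / 2))"
    by simp
  also have "(\<Prod>b\<in>Basis. exp (- (t \<bullet> b)\<^sup>2 / 2)) = exp (- (norm t)\<^sup>2 / 2)"
    by (simp add: norm_square_Basis[of t] exp_sum[symmetric] sum_negf sum_divide_distrib)
  finally show ?thesis .
qed

text \<open>The Gaussian kernel is itself a characteristic function, hence an average of characters
  over \<open>z\<close>. Exchanging the two integrals leaves only the characteristic function of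
  \<mu>. The parameter \<open>s\<close> is the inverse width of the kernel.\<close>

lemma gauss_bump_eq_char:
  fixes \<mu> :: "'a::euclidean_space measure"
  assumes "prob_space \<mu>" and [measurable_cong]: "sets \<mu> = sets borel"
  shows "complex_of_real (\<integral>w. exp (- (norm (s *\<^sub>R (x - w)))\<^sup>2 / 2) \<partial>\<mu>) =
    (CLINT z|std_gauss. iexp (s *\<^sub>R x \<bullet> z) * (CLINT w|\<mu>. iexp ((- s *\<^sub>R z) \<bullet> w)))"
proof -
  interpret \<mu>: prob_space \<mu> by fact
  interpret g: prob_space "std_gauss :: 'a measure" by (rule prob_space_std_gauss)
  interpret pair_prob_space \<mu> "std_gauss :: 'a measure" ..
  have int: "integrable (\<mu> \<Otimes>\<^sub>M std_gauss) (case_prod (\<lambda>w z. iexp ((s *\<^sub>R (x - w)) \<bullet> z)))"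
    by (rule integrable_const_bound[where B=1]) (auto simp: split_beta')
  have "complex_of_real (\<integral>w. exp (- (norm (s *\<^sub>R (x - w)))\<^sup>2 / 2) \<partial>\<mu>)
      = (CLINT w|\<mu>. CLINT z|std_gauss. iexp ((s *\<^sub>R (x - w)) \<bullet> z))"
    unfolding char_std_gauss by simp
  also have "\<dots> = (CLINT z|std_gauss. CLINT w|\<mu>. iexp ((s *\<^sub>R (x - w)) \<bullet> z))"
    by (rule Fubini_integral[OF int, symmetric])
  also have "\<dots> = (CLINT z|std_gauss. CLINT w|\<mu>. iexp (s *\<^sub>R x \<bullet> z) * iexp ((- s *\<^sub>R z) \<bullet> w))"
    by (simp add: exp_add[symmetric] algebra_simps inner_diff_left inner_commute)
  finally show ?thesis
    by simp
qed

text \<open>After the previous rewriting the outer integral is against a probability measure and the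
  characteristic functions are bounded by 1, so dominated convergence applies with a constant
  bound.\<close>

lemma gauss_bump_tendsto:
  fixes \<mu> :: "nat \<Rightarrow> 'a::euclidean_space measure"
  assumes "\<And>n. prob_space (\<mu> n)" and [measurable_cong]: "\<And>n. sets (\<mu> n) = sets borel"
    and "prob_space \<mu>'" and [measurable_cong]: "sets \<mu>' = sets borel"
    and "\<And>t. (\<lambda>n. CLINT w|\<mu> n. iexp (t \<bullet> w)) \<longlonglongrightarrow> (CLINT w|\<mu>'. iexp (t \<bullet> w))"
  shows "(\<lambda>n. \<integral>w. exp (- (norm (s *\<^sub>R (x - w)))\<^sup>2 / 2) \<partial>\<mu> n)
    \<longlonglongrightarrow> (\<integral>w. exp (- (norm (s *\<^sub>R (x - w)))\<^sup>2 / 2) \<partial>\<mu>')"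
proof -
  interpret g: prob_space "std_gauss :: 'a measure" by (rule prob_space_std_gauss)
  have bound: "norm (CLINT w|\<nu>. iexp (t \<bullet> w)) \<le> 1" if "prob_space \<nu>" for \<nu> :: "'a measure" and t
  proof -
    interpret \<nu>: prob_space \<nu> by fact
    have "norm (CLINT w|\<nu>. iexp (t \<bullet> w)) \<le> (\<integral>w. norm (iexp (t \<bullet> w)) \<partial>\<nu>)"
      by (rule integral_norm_bound)
    then show ?thesis by (simp add: \<nu>.prob_space)
  qed
  have meas: "(\<lambda>z. CLINT w|\<nu>. iexp ((- s *\<^sub>R z) \<bullet> w)) \<in> borel_measurable borel"
    if "prob_space \<nu>" and [measurable_cong]: "sets \<nu> = sets borel" for \<nu> :: "'a measure"
  proof -
    interpret \<nu>: prob_space \<nu> by fact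
    show ?thesis by measurable
  qed
  have "(\<lambda>n. complex_of_real (\<integral>w. exp (- (norm (s *\<^sub>R (x - w)))\<^sup>2 / 2) \<partial>\<mu> n))
    \<longlonglongrightarrow> complex_of_real (\<integral>w. exp (- (norm (s *\<^sub>R (x - w)))\<^sup>2 / 2) \<partial>\<mu>')"
    unfolding gauss_bump_eq_char[OF assms(1,2)] gauss_bump_eq_char[OF assms(3,4)]
  proof (rule integral_dominated_convergence[where w="\<lambda>_. 1"])
    show "AE z in std_gauss. norm (iexp (s *\<^sub>R x \<bullet> z) * (CLINT w|\<mu> n. iexp ((- s *\<^sub>R z) \<bullet> w))) \<le> 1" for n
      by (intro AE_I2, unfold norm_mult norm_exp_i_times mult_1_left, rule bound, rule assms)
    show "AE z in std_gauss. (\<lambda>n. iexp (s *\<^sub>R x \<bullet> z) * (CLINT w|\<mu> n. iexp ((- s *\<^sub>R z) \<bullet> w)))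
        \<longlonglongrightarrow> iexp (s *\<^sub>R x \<bullet> z) * (CLINT w|\<mu>'. iexp ((- s *\<^sub>R z) \<bullet> w))"
      using assms(5) by (intro AE_I2 tendsto_mult_left)
  qed (use meas assms in \<open>auto intro!: borel_measurable_times\<close>)
  then show ?thesis
    by (simp only: tendsto_of_real_iff)
qed

text \<open>Both sides are the probability that \<open>w + (1/s) *\<^sub>R z\<close> falls into
  \<open>D\<close>, with \<open>w\<close> drawn from \<mu> and \<open>z\<close> an independent
  standard Gaussian. The right side uses the Lebesgue density of this convolution; the power of
  \<open>s / sqrt (2 * pi)\<close> normalizes a Gaussian of variance
  \<open>1/s\<^sup>2\<close>.\<close>

lemma gauss_smoothing_eq:
  fixes \<mu> :: "'a::euclidean_space measure"
  assumes "prob_space \<mu>" and [measurable_cong]: "sets \<mu> = sets borel"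
    and [measurable]: "D \<in> sets borel" and s: "s > 0"
  shows "(\<integral>\<^sup>+w. emeasure std_gauss {z. w + (1/s) *\<^sub>R z \<in> D} \<partial>\<mu>) =
    (\<integral>\<^sup>+x. ennreal ((s / sqrt (2 * pi)) ^ DIM('a) * (\<integral>w. exp (- (norm (s *\<^sub>R (x - w)))\<^sup>2 / 2) \<partial>\<mu>))
       * indicator D x \<partial>lborel)"
proof -
  interpret \<mu>: prob_space \<mu> by fact
  interpret pair_sigma_finite \<mu> "lborel :: 'a measure" ..
  let ?c = "(s / sqrt (2 * pi)) ^ DIM('a)"
  let ?e = "\<lambda>x w::'a. exp (- (norm (s *\<^sub>R (x - w)))\<^sup>2 / 2)"
  have 1: "emeasure std_gauss {z. w + (1/s) *\<^sub>R z \<in> D}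
      = (\<integral>\<^sup>+x. ennreal (?c * ?e x w) * indicator D x \<partial>lborel)" for w :: 'a
  proof -
    have "(\<integral>\<^sup>+x. ennreal (?c * ?e x w) * indicator D x \<partial>lborel) =
        (\<integral>\<^sup>+x. ennreal (?c * ?e x w) * indicator D x
          \<partial>density (distr lborel borel (\<lambda>x. w + (1/s) *\<^sub>R x)) (\<lambda>_. (\<bar>1/s\<bar>^DIM('a))))"
      using s by (subst lborel_affine[of "1/s" w]) simp_all
    also have "\<dots> = (\<integral>\<^sup>+z. ennreal (\<bar>1/s\<bar>^DIM('a)) * (ennreal (?c * exp (- (norm z)\<^sup>2 / 2))
         * indicator D (w + (1/s) *\<^sub>R z)) \<partial>lborel)"
      using s by (subst nn_integral_density) (auto simp: nn_integral_distr)
    also have "\<dots> = (\<integral>\<^sup>+z. ennreal (gauss_density z) * indicator {z. w + (1/s) *\<^sub>R z \<in> D} z \<partial>lborel)"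
    proof (intro nn_integral_cong)
      fix z :: 'a
      have "\<bar>1/s\<bar>^DIM('a) * (?c * exp (- (norm z)\<^sup>2 / 2)) = gauss_density z"
        using s by (simp add: gauss_density_eq power_divide)
      then have "ennreal (\<bar>1/s\<bar>^DIM('a)) * ennreal (?c * exp (- (norm z)\<^sup>2 / 2)) = ennreal (gauss_density z)"
        by (subst ennreal_mult''[symmetric]) (use s in auto)
      then show "ennreal (\<bar>1/s\<bar>^DIM('a)) * (ennreal (?c * exp (- (norm z)\<^sup>2 / 2))
         * indicator D (w + (1/s) *\<^sub>R z)) = ennreal (gauss_density z) * indicator {z. w + (1/s) *\<^sub>R z \<in> D} z"
        by (simp add: mult.assoc[symmetric] indicator_def)
    qed
    also have "\<dots> = emeasure std_gauss {z. w + (1/s) *\<^sub>R z \<in> D}"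
      by (simp add: std_gauss_def emeasure_density)
    finally show ?thesis ..
  qed
  have "(\<integral>\<^sup>+w. emeasure std_gauss {z. w + (1/s) *\<^sub>R z \<in> D} \<partial>\<mu>) =
      (\<integral>\<^sup>+w. (\<integral>\<^sup>+x. ennreal (?c * ?e x w) * indicator D x \<partial>lborel) \<partial>\<mu>)"
    by (simp add: 1)
  also have "\<dots> = (\<integral>\<^sup>+x. (\<integral>\<^sup>+w. ennreal (?c * ?e x w) * indicator D x \<partial>\<mu>) \<partial>lborel)"
    by (rule Fubini'[symmetric]) measurable
  also have "\<dots> = (\<integral>\<^sup>+x. ennreal (?c * (\<integral>w. ?e x w \<partial>\<mu>)) * indicator D x \<partial>lborel)"
  proof (intro nn_integral_cong)
    fix x :: 'a
    have "integrable \<mu> (\<lambda>w. ?c * ?e x w)"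
      by (intro integrable_mult_right \<mu>.integrable_const_bound[where B=1]) auto
    then have "(\<integral>\<^sup>+w. ennreal (?c * ?e x w) \<partial>\<mu>) = ennreal (\<integral>w. ?c * ?e x w \<partial>\<mu>)"
      using s by (intro nn_integral_eq_integral) auto
    then show "(\<integral>\<^sup>+w. ennreal (?c * ?e x w) * indicator D x \<partial>\<mu>) = ennreal (?c * (\<integral>w. ?e x w \<partial>\<mu>)) * indicator D x"
      by (subst nn_integral_multc) auto
  qed
  finally show ?thesis .
qed

text \<open>Inner regularity supplies a compact set almost as heavy as \<open>A\<close>, and
  compactness keeps it at positive distance from the complement of \<open>A\<close>. The margin is
  \<open>2 * \<delta>\<close> so that two errors can be absorbed: one \<delta> for passing from
  \<open>K\<close> to a neighbourhood, one for a further shift.\<close>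

lemma open_prob_inner_thickening:
  fixes \<mu> :: "'a::euclidean_space measure"
  assumes "prob_space \<mu>" and sets: "sets \<mu> = sets borel" and opn: "open A" and c: "c < measure \<mu> A"
  obtains K \<delta> where "compact K" "c < measure \<mu> K" "\<delta> > 0"
    "\<And>x y. x \<in> K \<Longrightarrow> dist x y < 2 * \<delta> \<Longrightarrow> y \<in> A"
proof -
  interpret prob_space \<mu> by fact
  obtain K where K: "compact K" "K \<subseteq> A" "c < measure \<mu> K"
  \<comment> \<open>\<open>ennreal\<close> sends negative numbers to 0, which could destroy the
    strict inequality below; for negative \<open>c\<close> the empty set serves.\<close>
  proof (cases "c < 0")
    case True
    show ?thesis by (rule that[of "{}"]) (use True in auto)
  next
    case False
    have "emeasure \<mu> A = (SUP K\<in>{K. K \<subseteq> A \<and> compact K}. emeasure \<mu> K)"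
      using opn by (intro inner_regular sets) auto
    moreover have "ennreal c < emeasure \<mu> A"
      using c False by (auto simp: emeasure_eq_measure intro!: ennreal_lessI)
    ultimately obtain K where "K \<subseteq> A" "compact K" "ennreal c < emeasure \<mu> K"
      by (auto simp: less_SUP_iff)
    then show ?thesis
      using that[of K] False by (auto simp: emeasure_eq_measure ennreal_less_iff)
  qed
  obtain \<delta> where "\<delta> > 0" "\<And>x y. x \<in> K \<Longrightarrow> dist x y < 2 * \<delta> \<Longrightarrow> y \<in> A"
  proof -
    consider e where "e > 0" "{x. infdist x K \<le> e} \<subseteq> A" | "K = {}"
      using compact_in_open_separated[of K A] K opn by auto
    then show ?thesis
    proof cases
      case 1
      have "y \<in> A" if "x \<in> K" "dist x y < 2 * (e / 2)" for x y
        using 1 infdist_le[OF that(1), of y] that(2) by (auto simp: dist_commute)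
      then show ?thesis using that[of "e/2"] 1 by auto
    qed (use that[of 1] in auto)
  qed
  with K show ?thesis using that by blast
qed

text \<open>Portmanteau inequality without tightness: convolving with a small Gaussian turns convergence of
  characteristic functions into pointwise convergence of densities, to which Fatou's lemma applies.\<close>

lemma char_tendsto_imp_open_liminf:
  fixes \<mu> :: "nat \<Rightarrow> 'a::euclidean_space measure"
  assumes prob: "\<And>n. prob_space (\<mu> n)" and sets[measurable_cong]: "\<And>n. sets (\<mu> n) = sets borel"
    and prob': "prob_space \<mu>'" and sets'[measurable_cong]: "sets \<mu>' = sets borel"
    and char: "\<And>t. (\<lambda>n. CLINT w|\<mu> n. iexp (t \<bullet> w)) \<longlonglongrightarrow> (CLINT w|\<mu>'. iexp (t \<bullet> w))"
    and opn: "open A" and c: "c < measure \<mu>' A"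
  shows "eventually (\<lambda>n. c < measure (\<mu> n) A) sequentially"
proof -
  interpret \<mu>': prob_space \<mu>' by fact
  interpret g: prob_space "std_gauss :: 'a measure" by (rule prob_space_std_gauss)
  obtain K \<delta> where K: "compact K" "c < measure \<mu>' K"
    and \<delta>: "\<delta> > 0" "\<And>x y. x \<in> K \<Longrightarrow> dist x y < 2 * \<delta> \<Longrightarrow> y \<in> A"
    using open_prob_inner_thickening[OF prob' sets' opn c] by metis
  define D where "D = (\<Union>x\<in>K. ball x \<delta>)"
  have [measurable]: "D \<in> sets borel"
    unfolding D_def by (intro borel_open open_UN ballI open_ball)
  \<comment> \<open>The gap is cut in three: one \<eta> is lost in the lower bound of
    \<open>p\<close> on \<open>K\<close>, one in the upper bound by the indicator of
    \<open>A\<close>, and the third keeps the inequality strict for the limit.\<close>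
  define \<eta> where "\<eta> = (measure \<mu>' K - c) / 3"
  have "\<eta> > 0" using K by (simp add: \<eta>_def)
  \<comment> \<open>Choice of the kernel width: the tails decrease to the empty set, so some integer
    \<open>m\<close> makes a shift of length at least \<delta> less likely than \<eta>.\<close>
  have "(\<lambda>n. measure std_gauss {z::'a. real n * \<delta> \<le> norm z}) \<longlonglongrightarrow> measure std_gauss (\<Inter>n. {z::'a. real n * \<delta> \<le> norm z})"
  proof (rule g.finite_Lim_measure_decseq)
    have "real k * \<delta> \<le> real l * \<delta>" if "k \<le> l" for k l
      using that \<delta>(1) by (simp add: mult_right_mono)
    then show "decseq (\<lambda>n. {z::'a. real n * \<delta> \<le> norm z})"
      unfolding decseq_def by (blast intro: order_trans)
  qed auto
  moreover have "(\<Inter>n. {z::'a. real n * \<delta> \<le> norm z}) = {}"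
    using reals_Archimedean3[OF \<delta>(1)] by (simp add: set_eq_iff not_le)
  ultimately have "eventually (\<lambda>n. measure std_gauss {z::'a. real n * \<delta> \<le> norm z} < \<eta>) sequentially"
    using \<open>\<eta> > 0\<close> by (auto dest: order_tendstoD(2))
  then have "eventually (\<lambda>n. n > 0 \<and> measure std_gauss {z::'a. real n * \<delta> \<le> norm z} < \<eta>) sequentially"
    by (intro eventually_conj eventually_gt_at_top)
  then obtain m :: nat where "m > 0" and m: "measure std_gauss {z::'a. real m * \<delta> \<le> norm z} < \<eta>"
    by (auto simp: eventually_sequentially)
  define s where "s = real m"
  have s: "s > 0" "measure std_gauss {z::'a. s * \<delta> \<le> norm z} < \<eta>"
    using \<open>m > 0\<close> m by (auto simp: s_def)
  \<comment> \<open>\<open>p\<close> is the smoothed indicator of \<open>D\<close>. As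
    \<open>D\<close> lies between \<open>K\<close> and \<open>A\<close> with room \<delta> on either
    side, \<open>p\<close> is squeezed between \<open>(1 - \<eta>) * indicator K\<close> and
    \<open>indicator A + \<eta>\<close>.\<close>
  define p where "p w = measure std_gauss {z::'a. w + (1/s) *\<^sub>R z \<in> D}" for w
  have p_meas [measurable]: "p \<in> borel_measurable borel"
    unfolding p_def by measurable
  have p_int: "integrable \<nu> p" if "prob_space \<nu>" "sets \<nu> = sets borel" for \<nu>
  proof -
    interpret \<nu>: prob_space \<nu> by fact
    show ?thesis
      using that p_meas by (intro \<nu>.integrable_const_bound[where B=1]) (auto simp: p_def cong: measurable_cong_sets)
  qed
  have nn_p: "(\<integral>\<^sup>+w. emeasure std_gauss {z. w + (1/s) *\<^sub>R z \<in> D} \<partial>\<nu>) = ennreal (\<integral>w. p w \<partial>\<nu>)"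
    if "prob_space \<nu>" "sets \<nu> = sets borel" for \<nu>
    unfolding g.emeasure_eq_measure p_def[symmetric]
    by (intro nn_integral_eq_integral p_int that) (auto simp: p_def)
  have far: "measure std_gauss {z::'a. norm ((1/s) *\<^sub>R z) \<ge> \<delta>} < \<eta>"
    using s by (simp add: field_simps)
  have lower: "(1 - \<eta>) * indicator K w \<le> p w" for w
  proof (cases "w \<in> K")
    case True
    have "1 - \<eta> \<le> 1 - measure std_gauss {z::'a. norm ((1/s) *\<^sub>R z) \<ge> \<delta>}" using far by simp
    also have "\<dots> = measure std_gauss (space std_gauss - {z::'a. norm ((1/s) *\<^sub>R z) \<ge> \<delta>})"
      by (subst g.prob_compl) auto
    also have "\<dots> \<le> p w"
      unfolding p_def
    proof (rule g.finite_measure_mono)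
      show "space std_gauss - {z::'a. norm ((1/s) *\<^sub>R z) \<ge> \<delta>} \<subseteq> {z. w + (1/s) *\<^sub>R z \<in> D}"
      proof
        fix z assume "z \<in> space std_gauss - {z::'a. norm ((1/s) *\<^sub>R z) \<ge> \<delta>}"
        then have "w + (1/s) *\<^sub>R z \<in> ball w \<delta>" by (auto simp: dist_norm)
        then show "z \<in> {z. w + (1/s) *\<^sub>R z \<in> D}" using True by (auto simp: D_def)
      qed
    qed measurable
    finally show ?thesis using True by simp
  qed (simp add: p_def)
  have upper: "p w \<le> indicator A w + \<eta>" for w
  proof (cases "w \<in> A")
    case True then show ?thesis using \<open>\<eta> > 0\<close> by (simp add: p_def add_increasing2)
  next
    case False
    have "p w \<le> measure std_gauss {z::'a. norm ((1/s) *\<^sub>R z) \<ge> \<delta>}"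
      unfolding p_def
    proof (rule g.finite_measure_mono)
      show "{z. w + (1/s) *\<^sub>R z \<in> D} \<subseteq> {z. norm ((1/s) *\<^sub>R z) \<ge> \<delta>}"
      proof (safe, rule ccontr)
        fix z assume "w + (1/s) *\<^sub>R z \<in> D" and z: "\<not> norm ((1/s) *\<^sub>R z) \<ge> \<delta>"
        then obtain x where x: "x \<in> K" "dist x (w + (1/s) *\<^sub>R z) < \<delta>" by (auto simp: D_def)
        have "dist x w \<le> dist x (w + (1/s) *\<^sub>R z) + dist (w + (1/s) *\<^sub>R z) w" by (rule dist_triangle)
        also have "dist (w + (1/s) *\<^sub>R z) w = norm ((1/s) *\<^sub>R z)" by (simp add: dist_norm)
        finally have "dist x w < 2 * \<delta>" using x z by linarith
        with \<delta>(2) x False show False by blast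
      qed
    qed measurable
    then show ?thesis using far False by simp
  qed
  let ?b = "\<lambda>\<nu> x::'a. (s / sqrt (2 * pi)) ^ DIM('a) * (\<integral>w. exp (- (norm (s *\<^sub>R (x - w)))\<^sup>2 / 2) \<partial>\<nu>)"
  have "ennreal (\<integral>w. p w \<partial>\<mu>') = (\<integral>\<^sup>+x. ennreal (?b \<mu>' x) * indicator D x \<partial>lborel)"
    using gauss_smoothing_eq[OF prob' sets' _ s(1), of D] nn_p[OF prob' sets'] by simp
  also have "\<dots> = (\<integral>\<^sup>+x. liminf (\<lambda>n. ennreal (?b (\<mu> n) x) * indicator D x) \<partial>lborel)"
  proof (intro nn_integral_cong)
    fix x
    have "(\<lambda>n. ennreal (?b (\<mu> n) x) * indicator D x) \<longlonglongrightarrow> ennreal (?b \<mu>' x) * indicator D x"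
      using gauss_bump_tendsto[OF prob sets prob' sets' char, of s x]
      by (cases "x \<in> D") (auto intro!: tendsto_intros)
    then show "ennreal (?b \<mu>' x) * indicator D x = liminf (\<lambda>n. ennreal (?b (\<mu> n) x) * indicator D x)"
      by (intro lim_imp_Liminf[symmetric]) auto
  qed
  also have "\<dots> \<le> liminf (\<lambda>n. \<integral>\<^sup>+x. ennreal (?b (\<mu> n) x) * indicator D x \<partial>lborel)"
  proof (rule nn_integral_liminf)
    fix n
    interpret prob_space "\<mu> n" by (rule prob)
    show "(\<lambda>x. ennreal (?b (\<mu> n) x) * indicator D x) \<in> borel_measurable lborel" by measurable
  qed
  also have "(\<lambda>n. \<integral>\<^sup>+x. ennreal (?b (\<mu> n) x) * indicator D x \<partial>lborel) = (\<lambda>n. ennreal (\<integral>w. p w \<partial>\<mu> n))"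
    using gauss_smoothing_eq[OF prob sets _ s(1), of D] nn_p[OF prob sets] by auto
  finally have fatou: "ennreal (\<integral>w. p w \<partial>\<mu>') \<le> liminf (\<lambda>n. ennreal (\<integral>w. p w \<partial>\<mu> n))" .
  have K_meas: "K \<in> sets \<mu>'" using K(1) sets' by (simp add: borel_compact)
  have "c + \<eta> < (1 - \<eta>) * measure \<mu>' K"
  proof -
    have "\<eta> * measure \<mu>' K \<le> \<eta>" using \<open>\<eta> > 0\<close> by (simp add: mult_left_le)
    moreover have "measure \<mu>' K = c + 3 * \<eta>" by (simp add: \<eta>_def field_simps)
    ultimately show ?thesis
      using \<open>\<eta> > 0\<close> unfolding left_diff_distrib mult_1_left by linarith
  qed
  also have "\<dots> = (\<integral>w. (1 - \<eta>) * indicator K w \<partial>\<mu>')"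
    using K_meas by simp
  also have "\<dots> \<le> (\<integral>w. p w \<partial>\<mu>')"
    using K_meas p_int[OF prob' sets'] lower
    by (intro integral_mono) (auto intro!: integrable_mult_right integrable_real_indicator simp: \<mu>'.emeasure_eq_measure)
  finally have less: "c + \<eta> < (\<integral>w. p w \<partial>\<mu>')" .
  have "eventually (\<lambda>n. c + \<eta> < (\<integral>w. p w \<partial>\<mu> n)) sequentially"
  proof (cases "c + \<eta> < 0")
    case True
    have "0 \<le> (\<integral>w. p w \<partial>\<mu> n)" for n by (rule integral_nonneg_AE) (auto simp: p_def)
    with True show ?thesis by (auto intro!: always_eventually elim: less_le_trans)
  next
    case False
    then have "ennreal (c + \<eta>) < ennreal (\<integral>w. p w \<partial>\<mu>')" using less by (intro ennreal_lessI) auto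
    with fatou have "ennreal (c + \<eta>) < liminf (\<lambda>n. ennreal (\<integral>w. p w \<partial>\<mu> n))" by simp
    then have "eventually (\<lambda>n. ennreal (c + \<eta>) < ennreal (\<integral>w. p w \<partial>\<mu> n)) sequentially"
      by (rule less_LiminfD)
    then show ?thesis
      using False by (auto simp: ennreal_less_iff elim!: eventually_mono)
  qed
  then show ?thesis
  proof (rule eventually_mono)
    fix n assume "c + \<eta> < (\<integral>w. p w \<partial>\<mu> n)"
    also have "\<dots> \<le> (\<integral>w. indicator A w + \<eta> \<partial>\<mu> n)"
    proof -
      interpret prob_space "\<mu> n" by (rule prob)
      show ?thesis
        using opn sets upper
        by (intro integral_mono p_int prob) (auto simp: emeasure_eq_measure)
    qed
    also have "\<dots> = measure (\<mu> n) A + \<eta>"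
    proof -
      interpret prob_space "\<mu> n" by (rule prob)
      show ?thesis
        using opn sets by (subst Bochner_Integration.integral_add) (auto simp: emeasure_eq_measure prob_space)
    qed
    finally show "c < measure (\<mu> n) A" by simp
  qed
qed

section \<open>The multivariate normal distribution\<close>

text \<open>The uniqueness argument for Haar measure: the double integral of
  \<open>indicator A x * indicator ?B (y + x)\<close> is evaluated once by invariance of
  \<open>lborel\<close> in \<open>y\<close> and once by invariance of \<open>m\<close> in
  \<open>x\<close>.\<close>

lemma translation_invariant_eq_lborel:
  fixes m :: "'a::euclidean_space measure"
  assumes "sigma_finite_measure m" and [measurable_cong]: "sets m = sets borel"
    and inv: "\<And>v. distr m borel (\<lambda>x. v + x) = m"
    and A [measurable]: "A \<in> sets borel"
  shows "emeasure m A = emeasure m (box 0 One) * emeasure lborel A"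
proof -
  interpret m: sigma_finite_measure m by fact
  interpret pair_sigma_finite m "lborel :: 'a measure" ..
  let ?B = "box 0 One :: 'a set"
  have shift: "(\<integral>\<^sup>+x. f (v + x) \<partial>m) = (\<integral>\<^sup>+x. f x \<partial>m)" if [measurable]: "f \<in> borel_measurable borel" for f v
    by (subst inv[of v, symmetric]) (simp add: nn_integral_distr)
  \<comment> \<open>The sign is left open since the second evaluation integrates over
    \<open>x - y\<close> and therefore needs a reflection as well as a translation.\<close>
  have shift': "(\<integral>\<^sup>+x. f (v + c *\<^sub>R x) \<partial>lborel) = (\<integral>\<^sup>+x. f x \<partial>lborel)"
    if [measurable]: "f \<in> borel_measurable borel" and "\<bar>c\<bar> = 1" for f :: "'a \<Rightarrow> ennreal" and v c
    using that(2) by (subst (2) lborel_affine[of c v]) (auto simp: nn_integral_density nn_integral_distr)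
  have B1: "emeasure lborel ?B = 1"
    by (subst emeasure_lborel_box) auto
  have "emeasure m A = emeasure m A * emeasure lborel ?B"
    by (simp add: B1)
  also have "\<dots> = (\<integral>\<^sup>+x. indicator A x * emeasure lborel ?B \<partial>m)"
    by (simp add: nn_integral_multc)
  also have "\<dots> = (\<integral>\<^sup>+x. indicator A x * (\<integral>\<^sup>+y. indicator ?B (x + 1 *\<^sub>R y) \<partial>lborel) \<partial>m)"
    by (subst shift') (simp_all)
  also have "\<dots> = (\<integral>\<^sup>+x. (\<integral>\<^sup>+y. indicator A x * indicator ?B (y + x) \<partial>lborel) \<partial>m)"
    by (subst nn_integral_cmult) (simp_all add: add.commute)
  also have "\<dots> = (\<integral>\<^sup>+y. (\<integral>\<^sup>+x. indicator A x * indicator ?B (y + x) \<partial>m) \<partial>lborel)"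
    by (rule Fubini'[symmetric]) measurable
  also have "\<dots> = (\<integral>\<^sup>+y. (\<integral>\<^sup>+x. indicator A (- y + x) * indicator ?B x \<partial>m) \<partial>lborel)"
  proof (rule nn_integral_cong)
    fix y :: 'a
    show "(\<integral>\<^sup>+x. indicator A x * indicator ?B (y + x) \<partial>m) = (\<integral>\<^sup>+x. indicator A (- y + x) * indicator ?B x \<partial>m)"
      using shift[of "\<lambda>x. indicator A (- y + x) * indicator ?B x" y] by simp
  qed
  also have "\<dots> = (\<integral>\<^sup>+x. (\<integral>\<^sup>+y. indicator A (x + (-1) *\<^sub>R y) * indicator ?B x \<partial>lborel) \<partial>m)"
    by (subst Fubini') (auto simp: algebra_simps)
  also have "\<dots> = (\<integral>\<^sup>+x. emeasure lborel A * indicator ?B x \<partial>m)"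
    by (subst nn_integral_multc, measurable, subst shift') auto
  also have "\<dots> = emeasure m ?B * emeasure lborel A"
    by (simp add: nn_integral_cmult mult.commute)
  finally show ?thesis .
qed

text \<open>The scaling factor is left unidentified: in \<open>distr_mvnormal\<close> it is recovered from the total
  mass, so that no determinant has to be computed.\<close>

lemma distr_lborel_linear:
  fixes L L' :: "'a::euclidean_space \<Rightarrow> 'a"
  assumes L: "linear L" and L': "linear L'" and inv: "\<And>x. L (L' x) = x" "\<And>x. L' (L x) = x"
  shows "distr lborel borel L = density lborel (\<lambda>_. emeasure (distr lborel borel L) (box 0 One))"
proof -
  have [measurable]: "L \<in> borel_measurable borel" "L' \<in> borel_measurable borel"
    using L L' by (auto intro!: borel_measurable_continuous_onI linear_continuous_on simp: linear_linear)
  let ?m = "distr lborel borel L"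
  \<comment> \<open>The exhausting sets are the preimages of balls under the inverse
    \<open>L'\<close>; pulling them back along \<open>L\<close> returns the balls, which have finite
    Lebesgue measure.\<close>
  have sf: "sigma_finite_measure ?m"
  proof
    let ?C = "range (\<lambda>n. L' -` cball 0 (real n))"
    have bor: "L' -` cball 0 (real n) \<in> sets borel" for n
      using measurable_sets_borel[OF \<open>L' \<in> borel_measurable borel\<close>] by simp
    have em: "emeasure ?m (L' -` cball 0 (real n)) < \<infinity>" for n
    proof -
      have "L -` (L' -` cball 0 (real n)) = cball 0 (real n)" using inv by auto
      then show ?thesis
        using emeasure_lborel_cball_finite[of "0::'a" "real n"]
        by (simp add: bor emeasure_distr)
    qed
    have "(\<Union>n. L' -` cball 0 (real n)) = UNIV"
      using real_arch_simple by auto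
    then show "\<exists>A. countable A \<and> A \<subseteq> sets ?m \<and> \<Union> A = space ?m \<and> (\<forall>a\<in>A. emeasure ?m a \<noteq> \<infinity>)"
      using em bor by (intro exI[of _ ?C]) (auto simp: less_top)
  qed
  have tr: "distr ?m borel (\<lambda>x. v + x) = ?m" for v
  proof -
    have "distr ?m borel (\<lambda>x. v + x) = distr lborel borel (\<lambda>x. v + L x)"
      by (subst distr_distr) (auto simp: comp_def)
    \<comment> \<open>A translation by \<open>v\<close> after \<open>L\<close> is a translation by
      \<open>L' v\<close> before \<open>L\<close>, so the invariance of \<open>lborel\<close> is
      inherited.\<close>
    also have "(\<lambda>x. v + L x) = L \<circ> (\<lambda>x. L' v + x)"
      using L by (auto simp: linear_add inv)
    also have "distr lborel borel \<dots> = distr (distr lborel borel (\<lambda>x. L' v + x)) borel L"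
      by (subst distr_distr) auto
    finally show ?thesis by (simp add: lborel_distr_plus)
  qed
  show ?thesis
    by (rule measure_eqI)
      (auto simp: emeasure_density nn_integral_cmult translation_invariant_eq_lborel[OF sf _ tr, symmetric])
qed

lemma inner_matrix_vector: "x \<bullet> (A *v y) = (transpose A *v x) \<bullet> y" for A :: "real^'n^'m"
  by (simp add: dot_lmul_matrix)

text \<open>Gram-Schmidt for the inner product \<open>x \<bullet> (A *v y)\<close>: as long as fewer
  than \<open>CARD('p)\<close> vectors are found, some nonzero vector is orthogonal to all their
  images under \<open>A\<close>, and it can be normalized. The columns of \<open>P\<close> are the
  resulting basis. \<open>P\<close> replaces a matrix square root: \<open>A ** P\<close> times its
  transpose is \<open>A\<close>.\<close>

lemma pos_def_orthonormalization:
  fixes A :: "real^'p^'p"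
  assumes A: "positive_definite A"
  obtains P :: "real^'p^'p" where "transpose P ** A ** P = mat 1"
proof -
  have sym: "x \<bullet> (A *v y) = y \<bullet> (A *v x)" for x y
    using A inner_matrix_vector[of x A y] by (simp add: positive_definite_def inner_commute)
  have "\<exists>T. finite T \<and> card T = k \<and> (\<forall>x\<in>T. \<forall>y\<in>T. x \<bullet> (A *v y) = (if x = y then 1 else 0))"
    if "k \<le> CARD('p)" for k
    using that
  proof (induction k)
    case 0
    show ?case by (intro exI[of _ "{}"]) auto
  next
    case (Suc k)
    then obtain T where T: "finite T" "card T = k"
      "\<And>x y. x \<in> T \<Longrightarrow> y \<in> T \<Longrightarrow> x \<bullet> (A *v y) = (if x = y then 1 else 0)" by auto
    have "dim ((*v) A ` T) \<le> card ((*v) A ` T)" using T by (intro dim_le_card') auto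
    also have "\<dots> \<le> k" using T card_image_le by blast
    also have "\<dots> < DIM(real^'p)" using Suc.prems by simp
    finally obtain z where z: "z \<noteq> 0" "\<And>y. y \<in> span ((*v) A ` T) \<Longrightarrow> orthogonal z y"
      using orthogonal_to_subspace_exists by blast
    then have z0: "z \<bullet> (A *v y) = 0" if "y \<in> T" for y
      using that by (auto simp: orthogonal_def span_base)
    define q where "q = z \<bullet> (A *v z)"
    have "q > 0" using A z(1) by (auto simp: positive_definite_def q_def)
    define e where "e = (1 / sqrt q) *\<^sub>R z"
    have ee: "e \<bullet> (A *v e) = 1"
      using \<open>q > 0\<close> by (simp add: e_def matrix_vector_mult_scaleR q_def[symmetric] flip: power2_eq_square)
    have e0: "e \<bullet> (A *v y) = 0" if "y \<in> T" for y
      using z0[OF that] by (simp add: e_def)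
    have "e \<notin> T" using ee e0 by fastforce
    then show ?case
      using T ee e0 sym by (intro exI[of _ "insert e T"]) auto
  qed
  from this[of "CARD('p)"] obtain T where T: "finite T" "card T = CARD('p)"
      "\<And>x y. x \<in> T \<Longrightarrow> y \<in> T \<Longrightarrow> x \<bullet> (A *v y) = (if x = y then 1 else 0)" by auto
  obtain b where b: "bij_betw b (UNIV :: 'p set) T"
    using T by (metis finite_same_card_bij finite_class.finite_UNIV)
  define P :: "real^'p^'p" where "P = (\<chi> i j. b j $ i)"
  have "(transpose P ** (A ** P)) $ i $ j = b i \<bullet> (A *v b j)" for i j
    by (simp add: P_def matrix_matrix_mult_def transpose_def inner_vec_def matrix_vector_mult_def)
  also have "b i \<bullet> (A *v b j) = (if i = j then 1 else 0)" for i j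
    using T(3)[of "b i" "b j"] b by (auto simp: bij_betw_def inj_on_def)
  finally have "transpose P ** (A ** P) = mat 1"
    by (simp add: vec_eq_iff mat_def)
  then show ?thesis by (intro that[of P]) (simp add: matrix_mul_assoc)
qed

text \<open>The inverse of \<open>A\<close> is \<open>P ** transpose P\<close>, so the exponent of
  the density is minus half the squared norm of \<open>transpose P *v x\<close>, and
  \<open>transpose P\<close> is also the inverse of \<open>A ** P\<close>. Hence both measures are
  multiples of the one with density \<open>gauss_density (L' x)\<close>.\<close>

lemma distr_mvnormal:
  fixes A P :: "real^'p^'p" and W :: "'b \<Rightarrow> real^'p"
  assumes N: "prob_space N" and W: "distributed N lborel W (mvnormal_density 0 A)"
    and sym: "transpose A = A" and P: "transpose P ** A ** P = mat 1"
  shows "distr N lborel W = distr std_gauss borel ((*v) (A ** P))"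
proof -
  have P1: "P ** (transpose P ** A) = mat 1"
    using P by (simp add: matrix_left_right_inverse)
  have P2: "P ** transpose P ** A = mat 1" using P1 by (simp add: matrix_mul_assoc)
  have P3: "A ** (P ** transpose P) = mat 1" using P2 matrix_left_right_inverse by blast
  have inv: "matrix_inv A = P ** transpose P"
  proof -
    have "A ** matrix_inv A = mat 1 \<and> matrix_inv A ** A = mat 1"
      unfolding matrix_inv_def by (rule someI[of _ "P ** transpose P"]) (use P2 P3 in auto)
    then have "matrix_inv A ** (A ** (P ** transpose P)) = P ** transpose P"
      by (simp add: matrix_mul_assoc)
    then show ?thesis by (simp add: P3)
  qed
  define L where "L = (*v) (A ** P)"
  define L' where "L' = (*v) (transpose P)"
  have LL: "L (L' x) = x" "L' (L x) = x" for x
    using P P3 by (simp_all add: L_def L'_def matrix_vector_mul_assoc matrix_mul_assoc del: transpose_matrix_vector)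
  have lin: "linear L" "linear L'" by (auto simp: L_def L'_def)
  have [measurable]: "L \<in> borel_measurable borel" "L' \<in> borel_measurable borel"
    using lin by (auto intro!: borel_measurable_continuous_onI linear_continuous_on simp: linear_linear)
  have quad: "x \<bullet> (matrix_inv A *v x) = (norm (L' x))\<^sup>2" for x
    unfolding inv power2_norm_eq_inner L'_def
    by (simp only: matrix_vector_mul_assoc[symmetric] inner_matrix_vector)
  define K where "K = sqrt ((2 * pi) ^ CARD('p) * det A)"
  define k where "k = sqrt (2 * pi) ^ CARD('p) / K"
  have dens: "mvnormal_density 0 A x = k * gauss_density (L' x)" for x
  proof -
    have "mvnormal_density 0 A x = exp (- (norm (L' x))\<^sup>2 / 2) / K"
      by (simp only: mvnormal_density_def K_def diff_zero quad)
    then show ?thesis by (simp add: gauss_density_eq k_def)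
  qed
  define c where "c = emeasure (distr lborel borel L) (box 0 One)"
  define I where "I = (\<lambda>S. \<integral>\<^sup>+x. ennreal (gauss_density (L' x)) * indicator S x \<partial>lborel)"
  have "distr N lborel W = density lborel (mvnormal_density 0 A)"
    using W by (simp add: distributed_def)
  then have 1: "emeasure (distr N lborel W) S = ennreal k * I S" if [measurable]: "S \<in> sets borel" for S
    by (simp add: emeasure_density dens I_def ennreal_mult'' mult.assoc nn_integral_cmult)
  have 2: "emeasure (distr std_gauss borel L) S = c * I S" if [measurable]: "S \<in> sets borel" for S
  proof -
    have [measurable]: "L -` S \<in> sets borel"
      using measurable_sets_borel[OF \<open>L \<in> borel_measurable borel\<close> that] .
    have "emeasure (distr std_gauss borel L) S = (\<integral>\<^sup>+z. ennreal (gauss_density z) * indicator (L -` S) z \<partial>lborel)"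
      by (simp add: emeasure_distr std_gauss_def emeasure_density)
    also have "\<dots> = (\<integral>\<^sup>+z. ennreal (gauss_density z) * indicator S (L z) \<partial>lborel)"
      by (simp add: indicator_def)
    also have "\<dots> = (\<integral>\<^sup>+x. ennreal (gauss_density (L' x)) * indicator S x \<partial>distr lborel borel L)"
      by (subst nn_integral_distr) (auto simp: LL)
    also have "\<dots> = (\<integral>\<^sup>+x. ennreal (gauss_density (L' x)) * indicator S x \<partial>density lborel (\<lambda>_. c))"
      unfolding c_def by (subst distr_lborel_linear[OF lin LL]) rule
    also have "\<dots> = c * I S"
      by (simp add: nn_integral_density nn_integral_cmult I_def)
    finally show ?thesis .
  qed
  interpret N: prob_space N by fact
  interpret g: prob_space "std_gauss :: (real^'p) measure" by (rule prob_space_std_gauss)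
  have Wm: "W \<in> measurable N lborel" using W by (simp add: distributed_def)
  have "ennreal k * I UNIV = 1"
    using 1[of UNIV] prob_space.emeasure_space_1[OF N.prob_space_distr[OF Wm]] by simp
  moreover have "c * I UNIV = 1"
    using 2[of UNIV] prob_space.emeasure_space_1[OF g.prob_space_distr[of L borel]] by simp
  \<comment> \<open>\<open>k = k * (c * I UNIV) = c * (k * I UNIV) = c\<close>, which avoids a
    division in \<open>ennreal\<close>.\<close>
  ultimately have "ennreal k = c"
    by (metis (no_types) mult.assoc mult.commute mult.right_neutral)
  with 1 2 show ?thesis
    unfolding L_def[symmetric] by (intro measure_eqI) auto
qed

text \<open>For \<open>W\<close> distributed as \<open>A ** P\<close> applied to a standard
  Gaussian, the matrix moves to the other side of the inner product as \<open>?Q\<close>, and the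
  squared norm of \<open>?Q *v t\<close> is \<open>t \<bullet> (A *v t)\<close> because
  \<open>P ** transpose P\<close> inverts \<open>A\<close>.\<close>

lemma char_mvnormal:
  fixes A :: "real^'p^'p" and W :: "'b \<Rightarrow> real^'p"
  assumes N: "prob_space N" and W: "distributed N lborel W (mvnormal_density 0 A)"
    and A: "positive_definite A"
  shows "(CLINT \<omega>|N. iexp (t \<bullet> W \<omega>)) = exp (- (t \<bullet> (A *v t)) / 2)"
proof -
  obtain P :: "real^'p^'p" where P: "transpose P ** A ** P = mat 1"
    by (rule pos_def_orthonormalization[OF A])
  have sym: "transpose A = A" using A by (simp add: positive_definite_def)
  have P1: "P ** (transpose P ** A) = mat 1"
    using P by (simp add: matrix_left_right_inverse)
  have Wm: "W \<in> measurable N lborel" using W by (simp add: distributed_def)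
  have [measurable]: "(*v) (A ** P) \<in> borel_measurable borel"
    by (auto intro!: borel_measurable_continuous_onI linear_continuous_on simp: linear_linear)
  let ?Q = "transpose P ** A"
  have tr: "t \<bullet> (A ** P *v z) = (?Q *v t) \<bullet> z" for z
    unfolding inner_matrix_vector by (simp only: matrix_transpose_mul sym)
  have "(norm (?Q *v t))\<^sup>2 = t \<bullet> (A *v t)"
  proof -
    have "(norm (?Q *v t))\<^sup>2 = t \<bullet> (A ** P *v (?Q *v t))"
      by (simp add: power2_norm_eq_inner tr)
    also have "A ** P *v (?Q *v t) = A *v t"
      by (simp only: matrix_vector_mul_assoc matrix_mul_assoc[symmetric] P1 matrix_mul_rid)
    finally show ?thesis .
  qed
  moreover have "(CLINT \<omega>|N. iexp (t \<bullet> W \<omega>)) = (CLINT x|distr N lborel W. iexp (t \<bullet> x))"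
    using Wm by (subst integral_distr) auto
  moreover have "\<dots> = (CLINT z|std_gauss. iexp ((?Q *v t) \<bullet> z))"
    unfolding distr_mvnormal[OF N W sym P] by (subst integral_distr) (auto simp: tr)
  ultimately show ?thesis
    by (simp add: char_std_gauss)
qed

section \<open>Patterns and first-order optimality\<close>

abbreviation max_inner :: "'i set \<Rightarrow> ('i \<Rightarrow> real^'p) \<Rightarrow> real^'p \<Rightarrow> real" where
  "max_inner S v x \<equiv> Max ((\<lambda>i. v i \<bullet> x) ` S)"

lemma pattern_eq: "pattern S v x = {i\<in>S. \<forall>j\<in>S. v j \<bullet> x \<le> v i \<bullet> x}"
  unfolding pattern_def is_arg_max_def by (auto simp: not_less)

lemma pattern_subset: "pattern S v x \<subseteq> S"
  by (auto simp: pattern_eq)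

lemma finite_pattern: "finite S \<Longrightarrow> finite (pattern S v x)"
  by (rule finite_subset[OF pattern_subset])

lemma max_inner_pattern:
  assumes "finite S" "i \<in> pattern S v x"
  shows "max_inner S v x = v i \<bullet> x"
  using assms by (intro Max_eqI) (auto simp: pattern_eq)

lemma pattern_nonempty:
  assumes "finite S" "S \<noteq> {}"
  shows "pattern S v x \<noteq> {}"
proof -
  have "max_inner S v x \<in> (\<lambda>i. v i \<bullet> x) ` S" using assms by (intro Max_in) auto
  then obtain i where "i \<in> S" "v i \<bullet> x = max_inner S v x" by auto
  then have "i \<in> pattern S v x" using assms by (auto simp: pattern_eq)
  then show ?thesis by auto
qed

lemma pattern_iff_inner_eq:
  assumes k: "k \<in> pattern S v x" and j: "j \<in> S"
  shows "j \<in> pattern S v x \<longleftrightarrow> v j \<bullet> x = v k \<bullet> x"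
proof
  assume "j \<in> pattern S v x"
  then show "v j \<bullet> x = v k \<bullet> x" using k by (intro order_antisym) (simp_all add: pattern_eq)
next
  assume "v j \<bullet> x = v k \<bullet> x"
  then show "j \<in> pattern S v x" using k j by (simp add: pattern_eq)
qed

lemma pattern_scaleR: "t > 0 \<Longrightarrow> pattern S v (t *\<^sub>R x) = pattern S v x"
  by (auto simp: pattern_eq)

text \<open>Two points with the same pattern share a maximal index \<open>k\<close>. Measured
  against this fixed \<open>k\<close>, ties at both points stay ties on the segment, and strict
  inequalities at both points stay strict.\<close>

lemma convex_pattern_cell:
  fixes v :: "'i \<Rightarrow> real^'p"
  assumes S: "finite S" "S \<noteq> {}"
  shows "convex {x. pattern S v x = p}"
proof (rule convexI)
  fix x y :: "real^'p" and a b :: real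
  assume xy: "x \<in> {x. pattern S v x = p}" "y \<in> {x. pattern S v x = p}"
    and ab: "a \<ge> 0" "b \<ge> 0" "a + b = 1"
  then have p: "pattern S v y = pattern S v x" by simp
  let ?z = "a *\<^sub>R x + b *\<^sub>R y"
  obtain k where k: "k \<in> pattern S v x" using pattern_nonempty[OF S] by blast
  have k': "k \<in> pattern S v y" using k p by simp
  have kS: "k \<in> S" by (rule subsetD[OF pattern_subset k])
  have lex: "v j \<bullet> x \<le> v k \<bullet> x" if "j \<in> S" for j using k that by (simp add: pattern_eq)
  have ley: "v j \<bullet> y \<le> v k \<bullet> y" if "j \<in> S" for j using k' that by (simp add: pattern_eq)
  have le: "v j \<bullet> ?z \<le> v k \<bullet> ?z" if "j \<in> S" for j
    using lex[OF that] ley[OF that] ab by (simp add: inner_add_right add_mono mult_left_mono)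
  have kz: "k \<in> pattern S v ?z" using le kS by (simp add: pattern_eq)
  note iff = pattern_iff_inner_eq[OF kz] and iffx = pattern_iff_inner_eq[OF k]
    and iffy = pattern_iff_inner_eq[OF k']
  have "j \<in> pattern S v ?z \<longleftrightarrow> j \<in> pattern S v x" if j: "j \<in> S" for j
  proof (cases "j \<in> pattern S v x")
    case True
    then show ?thesis using iff[OF j] iffx[OF j] iffy[OF j] p by (auto simp: inner_add_right)
  next
    case False
    then have 1: "v j \<bullet> x < v k \<bullet> x" "v j \<bullet> y < v k \<bullet> y"
      using iffx[OF j] iffy[OF j] p lex[OF j] ley[OF j] by (simp_all add: less_le)
    have "v j \<bullet> ?z < v k \<bullet> ?z"
    \<comment> \<open>Strictness must come from a point with positive weight: from \<open>y\<close>
      if \<open>a = 0\<close>, otherwise from \<open>x\<close>.\<close>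
    proof (cases "a = 0")
      case True then show ?thesis using ab 1 by simp
    next
      case False
      then have "a * (v j \<bullet> x) < a * (v k \<bullet> x)" using ab 1 by simp
      moreover have "b * (v j \<bullet> y) \<le> b * (v k \<bullet> y)" using ab 1 by (intro mult_left_mono) auto
      ultimately show ?thesis by (simp add: inner_add_right)
    qed
    then show ?thesis using iff[OF j] False by simp
  qed
  then have "pattern S v ?z = pattern S v x"
    using pattern_subset[of S v ?z] pattern_subset[of S v x] by blast
  then show "?z \<in> {x. pattern S v x = p}" using xy by simp
qed

lemma borel_pattern_cell:
  assumes "finite S"
  shows "{x. pattern S v x = p} \<in> sets borel"
proof (cases "p \<subseteq> S")
  case True
  have 1: "{x. i \<in> pattern S v x} \<in> sets borel" for i
  proof (cases "i \<in> S")
    case True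
    have "{x. i \<in> pattern S v x} = (\<Inter>j\<in>S. {x. v j \<bullet> x \<le> v i \<bullet> x})"
      using True by (auto simp: pattern_eq)
    also have "closed \<dots>"
      by (intro closed_INT ballI closed_Collect_le continuous_intros)
    finally show ?thesis by (rule borel_closed)
  qed (auto simp: pattern_eq)
  have "{x. pattern S v x = p} = (\<Inter>i\<in>S. {x. i \<in> pattern S v x \<longleftrightarrow> i \<in> p})"
    using True pattern_subset[of S v] by (auto simp: set_eq_iff)
  also have "\<dots> \<in> sets borel"
  proof (cases "S = {}")
    case False
    have "{x. i \<in> pattern S v x \<longleftrightarrow> i \<in> p} \<in> sets borel" for i
      using 1[of i] borel_comp[OF 1[of i]] by (cases "i \<in> p") (auto simp: Compl_eq)
    then show ?thesis using assms False by (intro sets.finite_INT) auto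
  qed auto
  finally show ?thesis .
next
  case False
  then have "{x. pattern S v x = p} = {}" using pattern_subset[of S v] by blast
  then show ?thesis by simp
qed

text \<open>An index inactive at \<open>x\<close> is strictly dominated and, there being finitely
  many, stays so for all small \<open>z\<close>. The active indices agree at \<open>x\<close>, so
  among them only \<open>z\<close> decides. The subfamily of active indices is thus the family that
  governs the limit problem.\<close>

lemma pattern_add_small:
  assumes S: "finite S" "S \<noteq> {}"
  obtains e where "e > 0" "\<And>z. norm z < e \<Longrightarrow> pattern S v (x + z) = pattern (pattern S v x) v z"
    "\<And>z. norm z < e \<Longrightarrow> max_inner S v (x + z) = max_inner S v x + max_inner (pattern S v x) v z"
proof -
  let ?P = "pattern S v x"
  have P: "finite ?P" "?P \<noteq> {}" "?P \<subseteq> S"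
    using S by (simp_all add: pattern_nonempty finite_pattern pattern_subset)
  have "eventually (\<lambda>z. \<forall>j\<in>S - ?P. \<forall>i\<in>?P. v j \<bullet> (x + z) < v i \<bullet> (x + z)) (nhds 0)"
  proof (intro eventually_ball_finite ballI)
    fix j i assume ji: "j \<in> S - ?P" "i \<in> ?P"
    have "v j \<bullet> x < v i \<bullet> x"
      using ji pattern_iff_inner_eq[OF ji(2), of j] by (auto simp: pattern_eq less_le)
    have "((\<lambda>z. v i \<bullet> (x + z) - v j \<bullet> (x + z)) \<longlongrightarrow> v i \<bullet> (x + 0) - v j \<bullet> (x + 0)) (nhds 0)"
      by (intro tendsto_intros filterlim_ident)
    then have "eventually (\<lambda>z. v i \<bullet> (x + z) - v j \<bullet> (x + z) > 0) (nhds 0)"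
      by (rule order_tendstoD) (use \<open>v j \<bullet> x < v i \<bullet> x\<close> in simp)
    then show "eventually (\<lambda>z. v j \<bullet> (x + z) < v i \<bullet> (x + z)) (nhds 0)" by simp
  qed (use S P in auto)
  then obtain e where e: "e > 0" "\<And>z j i. norm z < e \<Longrightarrow> j \<in> S - ?P \<Longrightarrow> i \<in> ?P \<Longrightarrow> v j \<bullet> (x + z) < v i \<bullet> (x + z)"
    by (auto simp: eventually_nhds_metric dist_norm)
  have xeq: "v i \<bullet> x = v j \<bullet> x" if "i \<in> ?P" "j \<in> ?P" for i j
    using that pattern_iff_inner_eq[of j S v x i] pattern_subset[of S v x] by blast
  have pat: "pattern S v (x + z) = pattern ?P v z" if z: "norm z < e" for z
  proof (intro set_eqI iffI)
    fix i assume i: "i \<in> pattern S v (x + z)"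
    obtain k where k: "k \<in> ?P" using P by auto
    have "i \<in> ?P"
    proof (rule ccontr)
      assume "i \<notin> ?P"
      then have "v i \<bullet> (x + z) < v k \<bullet> (x + z)" using e(2)[OF z _ k, of i] i by (auto simp: pattern_eq[of S v "x+z"])
      moreover have "v k \<bullet> (x + z) \<le> v i \<bullet> (x + z)" using i k P(3) by (auto simp: pattern_eq[of S v "x+z"])
      ultimately show False by simp
    qed
    moreover have "v j \<bullet> z \<le> v i \<bullet> z" if "j \<in> ?P" for j
    proof -
      have "v j \<bullet> (x + z) \<le> v i \<bullet> (x + z)" using i that P(3) by (auto simp: pattern_eq[of S v "x+z"])
      then show ?thesis using xeq[OF that \<open>i \<in> ?P\<close>] by (simp add: inner_add_right)
    qed
    ultimately show "i \<in> pattern ?P v z" by (simp add: pattern_eq[of "pattern S v x"])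
  next
    fix i assume i: "i \<in> pattern ?P v z"
    then have iP: "i \<in> ?P" and le: "\<And>j. j \<in> ?P \<Longrightarrow> v j \<bullet> z \<le> v i \<bullet> z"
      by (simp_all add: pattern_eq[of "pattern S v x"])
    have "v j \<bullet> (x + z) \<le> v i \<bullet> (x + z)" if "j \<in> S" for j
    proof (cases "j \<in> ?P")
      case True then show ?thesis using le[OF True] xeq[OF True iP] by (simp add: inner_add_right)
    next
      case False then show ?thesis using e(2)[OF z _ iP, of j] that by auto
    qed
    then show "i \<in> pattern S v (x + z)" using iP P(3) by (auto simp: pattern_eq[of S v "x+z"])
  qed
  have "max_inner S v (x + z) = max_inner S v x + max_inner ?P v z" if z: "norm z < e" for z
  proof -
    obtain i where i: "i \<in> pattern ?P v z" using pattern_nonempty[OF P(1,2)] by blast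
    then have "i \<in> pattern S v (x + z)" "i \<in> ?P"
      using pat[OF z] subsetD[OF pattern_subset] by metis+
    then show ?thesis
      using max_inner_pattern[OF S(1), of i v "x + z"] max_inner_pattern[OF S(1), of i v x]
        max_inner_pattern[OF P(1) i] by (simp only: inner_add_right)
  qed
  with e(1) pat show ?thesis using that by blast
qed

section \<open>One-sided derivatives and Fermat's rule\<close>

lemma GDERIV_line:
  assumes "GDERIV s x :> d"
  shows "((\<lambda>t. (s (x + t *\<^sub>R u) - s x) / t) \<longlongrightarrow> u \<bullet> d) (at_right 0)"
proof -
  have 1: "((\<lambda>t. x + t *\<^sub>R u) has_derivative (\<lambda>t. t *\<^sub>R u)) (at (0::real))"
    by (auto intro!: derivative_eq_intros)
  have 2: "(s has_derivative (\<lambda>h. h \<bullet> d)) (at (x + 0 *\<^sub>R u))"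
    using assms by (simp add: gderiv_def)
  have "((\<lambda>t. s (x + t *\<^sub>R u)) has_derivative (\<lambda>t. (u \<bullet> d) * t)) (at 0)"
    using has_derivative_compose[OF 1 2] by (simp add: mult.commute)
  then have "((\<lambda>t. s (x + t *\<^sub>R u)) has_field_derivative (u \<bullet> d)) (at 0)"
    unfolding has_field_derivative_def .
  then have "((\<lambda>t. s (x + t *\<^sub>R u)) has_field_derivative (u \<bullet> d)) (at_right 0)"
    by (rule has_field_derivative_at_within)
  then show ?thesis
    by (simp add: has_field_derivative_iff)
qed

text \<open>A maximum of linear forms is exactly affine along a short initial piece of every ray,
  with slope given by the active forms; no remainder term has to be carried along.\<close>

lemma max_inner_line:
  assumes S: "finite S" "S \<noteq> {}"
  shows "eventually (\<lambda>t. max_inner S v (x + t *\<^sub>R u) = max_inner S v x + t * max_inner (pattern S v x) v u) (at_right 0)"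
proof -
  obtain e where e: "e > 0"
    "\<And>z. norm z < e \<Longrightarrow> max_inner S v (x + z) = max_inner S v x + max_inner (pattern S v x) v z"
    using pattern_add_small[OF S, of v x] by metis
  let ?P = "pattern S v x"
  have P: "finite ?P" "?P \<noteq> {}"
    using S by (simp_all add: pattern_nonempty finite_pattern pattern_subset)
  obtain k where k: "k \<in> pattern ?P v u" using pattern_nonempty[OF P] by blast
  have "((\<lambda>t. norm (t *\<^sub>R u)) \<longlongrightarrow> norm (0 *\<^sub>R u)) (at_right 0)"
    by (intro tendsto_intros)
  then have "eventually (\<lambda>t. norm (t *\<^sub>R u) < e) (at_right 0)"
    by (rule order_tendstoD) (use e in simp)
  moreover have "eventually (\<lambda>t. t > (0::real)) (at_right 0)"
    by (simp add: eventually_at_right_less)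
  ultimately show ?thesis
  proof eventually_elim
    case (elim t)
    then have "k \<in> pattern ?P v (t *\<^sub>R u)" using k by (simp add: pattern_scaleR)
    then show ?case
      using e(2)[OF elim(1)] max_inner_pattern[OF P(1) k] max_inner_pattern[OF P(1), of k v "t *\<^sub>R u"] by simp
  qed
qed

text \<open>Fermat's rule: if minus the gradient of the smooth part were not in the convex hull of the
  active vectors, a separating direction would be a direction of descent.\<close>

lemma minimizer_gradient_in_hull:
  assumes S: "finite S" "S \<noteq> {}" and s: "GDERIV s x :> d"
    and min: "\<And>z. max_inner S v x + s x \<le> max_inner S v z + s z"
  shows "- d \<in> convex hull (v ` pattern S v x)"
proof (rule ccontr)
  assume "- d \<notin> convex hull (v ` pattern S v x)"
  let ?P = "pattern S v x"
  have P: "finite ?P" "?P \<noteq> {}"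
    using S by (simp_all add: pattern_nonempty finite_pattern pattern_subset)
  have "closed (convex hull (v ` ?P))"
    using P by (intro compact_imp_closed finite_imp_compact_convex_hull) auto
  then obtain a b where ab: "a \<bullet> (- d) < b" "\<And>y. y \<in> convex hull (v ` ?P) \<Longrightarrow> a \<bullet> y > b"
    using separating_hyperplane_closed_point[of "convex hull (v ` ?P)" "- d"] \<open>- d \<notin> _\<close> by auto
  \<comment> \<open>Along \<open>?u\<close> the maximum has slope below \<open>- b\<close>, since
    all active vectors lie beyond the hyperplane, while the smooth part has slope
    \<open>a \<bullet> (- d)\<close>, which is below \<open>b\<close>. The total slope is
    negative.\<close>
  let ?u = "- a"
  have "max_inner ?P v ?u \<in> (\<lambda>i. v i \<bullet> ?u) ` ?P" using P by (intro Max_in) auto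
  then obtain i where "i \<in> ?P" "max_inner ?P v ?u = v i \<bullet> ?u" by auto
  then have m: "max_inner ?P v ?u < - b"
    using ab(2)[of "v i"] by (simp add: hull_inc inner_commute)
  have "eventually (\<lambda>t. (s (x + t *\<^sub>R ?u) - s x) / t < b) (at_right 0)"
    by (rule order_tendstoD(2)[OF GDERIV_line[OF s]]) (use ab(1) in simp)
  with max_inner_line[OF S, of v x ?u] eventually_at_right_less[of "0::real"]
  have "eventually (\<lambda>t. False) (at_right (0::real))"
  proof eventually_elim
    case (elim t)
    then have "s (x + t *\<^sub>R ?u) - s x < t * b" by (simp add: field_simps)
    moreover have "t * max_inner ?P v ?u < t * (- b)" using m elim by (intro mult_strict_left_mono)
    ultimately show False using min[of "x + t *\<^sub>R ?u"] elim(1) by linarith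
  qed
  then show False by simp
qed

text \<open>This puts the limit objective back into the form of a maximum of linear forms, over the
  indices active at \<open>x\<close>, plus a smooth function, so that Fermat's rule applies to
  it.\<close>

lemma dir_deriv_max_inner:
  assumes S: "finite S" "S \<noteq> {}" and g: "GDERIV g x :> d"
    and f: "\<And>x. f x = max_inner S v x + g x"
  shows "dir_deriv f x u = max_inner (pattern S v x) v u + u \<bullet> d"
  unfolding dir_deriv_def
proof (rule tendsto_Lim)
  have "((\<lambda>t. max_inner (pattern S v x) v u + (g (x + t *\<^sub>R u) - g x) / t) \<longlongrightarrow>
      max_inner (pattern S v x) v u + u \<bullet> d) (at_right 0)"
    by (intro tendsto_intros GDERIV_line g)
  moreover have "eventually (\<lambda>t. max_inner (pattern S v x) v u + (g (x + t *\<^sub>R u) - g x) / t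
      = (f (x + t *\<^sub>R u) - f x) / t) (at_right 0)"
    using max_inner_line[OF S, of v x u] eventually_at_right_less[of "0::real"]
    by eventually_elim (simp add: f field_simps)
  ultimately show "((\<lambda>t. (f (x + t *\<^sub>R u) - f x) / t) \<longlongrightarrow> max_inner (pattern S v x) v u + u \<bullet> d) (at_right 0)"
    using tendsto_cong by fastforce
qed simp

text \<open>By convexity the difference quotients on the segment towards \<open>z\<close> never
  exceed \<open>g z - g x\<close>, and the bound passes to their limit.\<close>

lemma convex_GDERIV_above_tangent:
  assumes g: "convex_on UNIV g" and d: "GDERIV g x :> d"
  shows "g x + (z - x) \<bullet> d \<le> g z"
proof -
  have "eventually (\<lambda>t. (g (x + t *\<^sub>R (z - x)) - g x) / t \<le> g z - g x) (at_right 0)"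
    using eventually_at_right_less[of "0::real"] eventually_at_right_real[of 0 "1::real", OF zero_less_one]
  proof eventually_elim
    case (elim t)
    have "g ((1 - t) *\<^sub>R x + t *\<^sub>R z) \<le> (1 - t) * g x + t * g z"
      using elim by (intro convex_onD[OF g]) auto
    moreover have "(1 - t) *\<^sub>R x + t *\<^sub>R z = x + t *\<^sub>R (z - x)" by (simp add: algebra_simps)
    ultimately show ?case using elim by (simp add: field_simps)
  qed
  then have "(z - x) \<bullet> d \<le> g z - g x"
    by (rule tendsto_upperbound[OF GDERIV_line[OF d]]) simp
  then show ?thesis by simp
qed

lemma continuous_on_max_inner:
  assumes "finite S" "S \<noteq> {}"
  shows "continuous_on UNIV (max_inner S v)"
  using assms
proof (induction rule: finite_ne_induct)
  case (singleton x) then show ?case by (auto intro!: continuous_intros)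
next
  case (insert x F)
  then have "max_inner (insert x F) v = (\<lambda>y. max (v x \<bullet> y) (max_inner F v y))"
    by (auto simp: fun_eq_iff)
  then show ?case using insert by (auto intro!: continuous_intros)
qed

text \<open>Both properties hold for the active vectors and cut out a hyperplane and a half-space,
  which are convex, so they extend to the hull. Together they say that \<open>s\<close> is a
  subgradient of the maximum at \<open>u\<close>.\<close>

lemma hull_pattern_inner:
  assumes S: "finite S" "S \<noteq> {}" and s: "s \<in> convex hull (v ` pattern S v u)"
  shows "s \<bullet> u = max_inner S v u" "s \<bullet> z \<le> max_inner S v z"
proof -
  have "convex hull (v ` pattern S v u) \<subseteq> {s. u \<bullet> s = max_inner S v u}"
    by (intro hull_minimal convex_hyperplane)
      (use S in \<open>auto simp: max_inner_pattern[of S _ v u] inner_commute[of u]\<close>)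
  then show "s \<bullet> u = max_inner S v u" using s by (auto simp: inner_commute)
  have "convex hull (v ` pattern S v u) \<subseteq> {s. z \<bullet> s \<le> max_inner S v z}"
    using S pattern_subset[of S v u]
    by (intro hull_minimal convex_halfspace_le) (auto simp: inner_commute[of z] intro!: Max_ge)
  then show "s \<bullet> z \<le> max_inner S v z" using s by (auto simp: inner_commute)
qed

section \<open>Coercivity and the stationarity relation of the limit problem\<close>

lemma positive_definite_coercive:
  fixes C :: "real^'p^'p"
  assumes "positive_definite C"
  obtains c where "c > 0" "\<And>x. c * (norm x)\<^sup>2 \<le> x \<bullet> (C *v x)"
proof -
  let ?q = "\<lambda>x::real^'p. x \<bullet> (C *v x)"
  have cont: "continuous_on (sphere 0 1) ?q" by (intro continuous_intros linear_continuous_on) (auto simp: linear_linear)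
  have "axis undefined 1 \<in> sphere (0::real^'p) 1" by simp
  then have "sphere (0::real^'p) 1 \<noteq> {}" by blast
  then obtain e where e: "e \<in> sphere 0 1" "\<And>x. x \<in> sphere 0 1 \<Longrightarrow> ?q e \<le> ?q x"
    using continuous_attains_inf[OF compact_sphere _ cont] by blast
  show ?thesis
  proof
    have "e \<noteq> 0" using e(1) by auto
    then show "?q e > 0" using assms by (auto simp: positive_definite_def)
    fix x :: "real^'p"
    show "?q e * (norm x)\<^sup>2 \<le> ?q x"
    proof (cases "x = 0")
      case False
      have "?q e \<le> ?q ((1 / norm x) *\<^sub>R x)" using False by (intro e(2)) auto
      also have "\<dots> = ?q x / (norm x)\<^sup>2"
        by (simp add: matrix_vector_mult_scaleR power2_eq_square)
      finally show ?thesis using False by (simp add: field_simps)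
    qed simp
  qed
qed

text \<open>Stationarity of \<open>u\<close> for the limit objective with noise \<open>w\<close>: the convex hull is the subdifferential
  at \<open>u\<close> of the maximum of the \<open>v i\<close>.\<close>

definition optimal_at ::
  "'i set \<Rightarrow> ('i \<Rightarrow> real^'p) \<Rightarrow> real^'p^'p \<Rightarrow> real^'p \<Rightarrow> real^'p \<Rightarrow> real^'p \<Rightarrow> bool" where
  "optimal_at S v C \<gamma> u w \<longleftrightarrow> w - C *v u - \<gamma> \<in> convex hull (v ` pattern S v u)"

text \<open>Subgradients are monotone, and adding \<open>C\<close> makes the relation strongly
  monotone. With \<open>w = w'\<close> this gives uniqueness of \<open>u\<close>; in general it
  makes the solution a Lipschitz function of the noise, from which its measurability is
  obtained.\<close>

lemma optimal_at_lipschitz: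
  assumes S: "finite S" "S \<noteq> {}"
    and c: "c > 0" "\<And>x. c * (norm x)\<^sup>2 \<le> x \<bullet> (C *v x)"
    and o: "optimal_at S v C \<gamma> u w" "optimal_at S v C \<gamma> u' w'"
  shows "c * norm (u - u') \<le> norm (w - w')"
proof -
  define s where "s = w - C *v u - \<gamma>"
  define s' where "s' = w' - C *v u' - \<gamma>"
  have s: "s \<in> convex hull (v ` pattern S v u)" "s' \<in> convex hull (v ` pattern S v u')"
    using o by (simp_all add: optimal_at_def s_def s'_def)
  have "0 \<le> (s - s') \<bullet> (u - u')"
    using hull_pattern_inner(1)[OF S s(1)] hull_pattern_inner(2)[OF S s(1), of u']
      hull_pattern_inner(1)[OF S s(2)] hull_pattern_inner(2)[OF S s(2), of u]
    by (simp add: inner_diff_left inner_diff_right)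
  also have "s - s' = (w - w') - C *v (u - u')"
    by (simp add: s_def s'_def matrix_vector_mult_diff_distrib)
  finally have "(u - u') \<bullet> (C *v (u - u')) \<le> (w - w') \<bullet> (u - u')"
    by (simp add: inner_diff_left inner_diff_right inner_commute)
  also have "\<dots> \<le> norm (w - w') * norm (u - u')" by (rule norm_cauchy_schwarz)
  finally have "c * (norm (u - u'))\<^sup>2 \<le> norm (w - w') * norm (u - u')"
    using c(2)[of "u - u'"] by linarith
  then have "c * norm (u - u') * norm (u - u') \<le> norm (w - w') * norm (u - u')"
    by (simp add: power2_eq_square mult.assoc)
  then show ?thesis
    by (cases "u = u'") (auto simp: mult_le_cancel_right)
qed

text \<open>The set is a finite union, over the patterns \<open>p\<close>, of the convex sets
  \<open>C(K \<inter> cell p) + \<gamma> + conv {v i | i \<in> p}\<close>.\<close>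

lemma negligible_frontier_optimal_at:
  assumes S: "finite S" "S \<noteq> {}" and K: "convex K"
  shows "negligible (frontier {w. \<exists>u\<in>K. optimal_at S v C \<gamma> u w})"
proof -
  define B where "B p = (\<Union>x\<in>(+) \<gamma> ` (*v) C ` (K \<inter> {u. pattern S v u = p}). \<Union>y\<in>convex hull (v ` p). {x + y})" for p
  have conv: "convex (B p)" for p
    unfolding B_def
    by (intro convex_sums convex_translation convex_linear_image convex_Int K convex_pattern_cell S convex_convex_hull) simp
  \<comment> \<open>All subsets of \<open>S\<close> are used as indices to have an evidently finite
    union; a subset that is not a pattern has an empty cell and contributes nothing.\<close>
  have eq: "{w. \<exists>u\<in>K. optimal_at S v C \<gamma> u w} = \<Union> (B ` Pow S)" (is "?A = _")
  proof (intro set_eqI iffI)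
    fix w assume "w \<in> ?A"
    then obtain u where u: "u \<in> K" "w - C *v u - \<gamma> \<in> convex hull (v ` pattern S v u)"
      by (auto simp: optimal_at_def)
    have "w = (\<gamma> + C *v u) + (w - C *v u - \<gamma>)" by simp
    then have "w \<in> B (pattern S v u)" unfolding B_def using u by blast
    then show "w \<in> \<Union> (B ` Pow S)" using pattern_subset[of S v u] by blast
  next
    fix w assume "w \<in> \<Union> (B ` Pow S)"
    then obtain u y where u: "u \<in> K" "y \<in> convex hull (v ` pattern S v u)" "w = \<gamma> + C *v u + y"
      by (auto simp: B_def)
    then have "w - C *v u - \<gamma> = y" by simp
    then have "optimal_at S v C \<gamma> u w" using u(2) unfolding optimal_at_def by (simp only:)
    with u(1) show "w \<in> ?A" by blast
  qed
  have "frontier (\<Union> (B ` Pow S)) \<subseteq> \<Union> (frontier ` (B ` Pow S))"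
    using S by (intro frontier_Union_subset) auto
  moreover have "negligible (\<Union> (frontier ` (B ` Pow S)))"
    using S conv by (intro negligible_Union) (auto intro: negligible_convex_frontier)
  ultimately show ?thesis unfolding eq by (rule negligible_subset[rotated])
qed

text \<open>Fermat's rule for the limit objective; symmetry of \<open>C\<close> makes
  \<open>C *v u\<close> the gradient of the quadratic part.\<close>

lemma limit_minimizer_optimal:
  assumes f: "max_linear_form f S v g" and G: "\<And>x. GDERIV g x :> G x" and C: "positive_definite C"
    and min: "is_arg_min (\<lambda>u. u \<bullet> (C *v u) / 2 - u \<bullet> w + dir_deriv f \<beta> u) (\<lambda>_. True) u"
  shows "optimal_at (pattern S v \<beta>) v C (G \<beta>) u w"
proof -
  have S: "finite S" "S \<noteq> {}" and feq: "\<And>x. f x = max_inner S v x + g x"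
    using f by (auto simp: max_linear_form_def)
  let ?P = "pattern S v \<beta>"
  have P: "finite ?P" "?P \<noteq> {}" using S by (simp_all add: finite_pattern pattern_nonempty)
  let ?s = "\<lambda>u. u \<bullet> (C *v u) / 2 - u \<bullet> w + u \<bullet> G \<beta>"
  have sym: "u \<bullet> (C *v h) = h \<bullet> (C *v u)" for u h
    using C inner_matrix_vector[of u C h] by (simp add: positive_definite_def inner_commute)
  have CD: "((\<lambda>u. C *v u) has_derivative (\<lambda>h. C *v h)) (at u)"
    by (intro linear_imp_has_derivative) simp
  have "GDERIV ?s u :> C *v u - w + G \<beta>"
    unfolding gderiv_def
    by (auto intro!: derivative_eq_intros CD simp: fun_eq_iff sym algebra_simps inner_add_right inner_diff_right)
  moreover have "max_inner ?P v u + ?s u \<le> max_inner ?P v z + ?s z" for z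
  proof -
    have "u \<bullet> (C *v u) / 2 - u \<bullet> w + dir_deriv f \<beta> u \<le> z \<bullet> (C *v z) / 2 - z \<bullet> w + dir_deriv f \<beta> z"
      using min by (auto simp: is_arg_min_linorder)
    then show ?thesis
      unfolding dir_deriv_max_inner[OF S G feq] by simp
  qed
  ultimately have "- (C *v u - w + G \<beta>) \<in> convex hull (v ` pattern ?P v u)"
    by (rule minimizer_gradient_in_hull[OF P])
  then show ?thesis by (simp add: optimal_at_def algebra_simps)
qed

section \<open>Stationarity of the rescaled minimizer in a finite sample\<close>

definition gram :: "nat \<Rightarrow> (nat \<Rightarrow> real^'p) \<Rightarrow> real^'p \<Rightarrow> real^'p" where
  "gram n x u = (1 / real n) *\<^sub>R (\<Sum>i<n. (x i \<bullet> u) *\<^sub>R x i)"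

definition score :: "nat \<Rightarrow> (nat \<Rightarrow> real^'p) \<Rightarrow> (nat \<Rightarrow> real) \<Rightarrow> real^'p" where
  "score n x e = (1 / sqrt (real n)) *\<^sub>R (\<Sum>i<n. e i *\<^sub>R x i)"

text \<open>Expanding the squared residuals around the true parameter: the factor
  \<open>sqrt n\<close> in the local variable cancels the normalizations of \<open>gram\<close> and
  \<open>score\<close>, so the quadratic part takes the shape it has in the limit.\<close>

lemma penalized_ls_expand:
  fixes x :: "nat \<Rightarrow> real^'p"
  assumes n: "n > 0" and D: "D = gram n x" and w: "w = score n x e"
  shows "penalized_ls n (\<lambda>i. x i \<bullet> \<beta> + e i) x h b = (\<Sum>i<n. (e i)\<^sup>2) / 2
    + ((sqrt n *\<^sub>R (b - \<beta>)) \<bullet> D (sqrt n *\<^sub>R (b - \<beta>)) / 2 - w \<bullet> (sqrt n *\<^sub>R (b - \<beta>))) + h b"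
proof -
  define z where "z = b - \<beta>"
  have "(L2_set (\<lambda>i. x i \<bullet> \<beta> + e i - x i \<bullet> b) {..<n})\<^sup>2 = (\<Sum>i<n. (e i - x i \<bullet> z)\<^sup>2)"
    by (simp add: L2_set_def sum_nonneg z_def inner_diff_right algebra_simps)
  also have "\<dots> = (\<Sum>i<n. (e i)\<^sup>2) + ((\<Sum>i<n. (x i \<bullet> z) * (x i \<bullet> z)) - 2 * (\<Sum>i<n. e i * (x i \<bullet> z)))"
    by (simp add: power2_diff sum.distrib sum_subtractf sum_distrib_left power2_eq_square algebra_simps)
  also have "(\<Sum>i<n. (x i \<bullet> z) * (x i \<bullet> z)) = (sqrt n *\<^sub>R z) \<bullet> D (sqrt n *\<^sub>R z)"
  proof -
    have "sqrt (real n) * t * (sqrt (real n) * t') / real n = t * t'" for t t'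
      using n by (simp add: field_simps)
    then show ?thesis
      by (simp add: D gram_def inner_sum_right sum_distrib_left sum_divide_distrib inner_commute)
  qed
  also have "(\<Sum>i<n. e i * (x i \<bullet> z)) = w \<bullet> (sqrt n *\<^sub>R z)"
    using n by (simp add: w score_def inner_sum_left)
  finally show ?thesis
    unfolding penalized_ls_def z_def by simp
qed

text \<open>Rescaled minimizers satisfy the limiting optimality relation up to a small perturbation of the
  noise; the bound on \<open>u\<close> comes from comparing the objective with its value at \<open>\<beta>\<close>.\<close>

lemma penalized_ls_near_optimal:
  fixes v :: "'i \<Rightarrow> real^'p"
  assumes f: "max_linear_form f S v g" and G: "\<And>x. GDERIV g x :> G x" and Gc: "continuous_on UNIV G"
    and C: "positive_definite C" and \<eta>: "\<eta> > 0"
  obtains \<delta> n0 where "\<delta> > 0" "n0 > 0"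
    "\<forall>n\<ge>n0. \<forall>x e. (\<forall>u. norm (gram n x u - C *v u) \<le> \<delta> * norm u) \<longrightarrow> norm (score n x e) \<le> R \<longrightarrow>
      (\<exists>b. is_arg_min (penalized_ls n (\<lambda>i. x i \<bullet> \<beta> + e i) x (\<lambda>b. sqrt (real n) * f b)) (\<lambda>_. True) b) \<and>
      (\<forall>b. is_arg_min (penalized_ls n (\<lambda>i. x i \<bullet> \<beta> + e i) x (\<lambda>b. sqrt (real n) * f b)) (\<lambda>_. True) b \<longrightarrow>
        (\<exists>w'. norm (w' - score n x e) \<le> \<eta> \<and>
          optimal_at (pattern S v \<beta>) v C (G \<beta>) (sqrt (real n) *\<^sub>R (b - \<beta>)) w'))"
proof -
  have S: "finite S" "S \<noteq> {}" and feq: "\<And>x. f x = max_inner S v x + g x" and g: "convex_on UNIV g"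
    using f by (auto simp: max_linear_form_def)
  obtain c where c: "c > 0" "\<And>x. c * (norm x)\<^sup>2 \<le> x \<bullet> (C *v x)"
    using positive_definite_coercive[OF C] by blast
  let ?P = "pattern S v \<beta>"
  obtain k where k: "k \<in> ?P" using pattern_nonempty[OF S] by blast
  \<comment> \<open>\<open>s\<close> is a subgradient of \<open>f\<close> at \<beta>. It bounds the
    penalty from below by an affine function, so the gain from the penalty is at most linear in the
    local variable.\<close>
  define s where "s = v k + G \<beta>"
  have sub: "f \<beta> + s \<bullet> (b - \<beta>) \<le> f b" for b
  proof -
    have "v k \<bullet> b \<le> max_inner S v b"
      using S subsetD[OF pattern_subset k] by (intro Max_ge) auto
    moreover have "s \<bullet> (b - \<beta>) = v k \<bullet> b - v k \<bullet> \<beta> + (b - \<beta>) \<bullet> G \<beta>"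
      by (simp add: s_def inner_add_left inner_diff_right inner_commute[of "b - \<beta>"])
    ultimately show ?thesis
      using convex_GDERIV_above_tangent[OF g G, of \<beta> b] max_inner_pattern[OF S(1) k]
      unfolding feq by linarith
  qed
  \<comment> \<open>A bound for \<open>norm (w - s)\<close>; the absolute value keeps it nonnegative
    when \<open>R\<close> is negative.\<close>
  define R' where "R' = \<bar>R\<bar> + norm s"
  \<comment> \<open>The comparison with \<beta> yields \<open>c / 2 * norm u \<le> 2 * R'\<close>
    for nonzero \<open>u\<close>; adding 1 makes the bound strict and \<rho> positive.\<close>
  define \<rho> where "\<rho> = 2 * R' * 2 / c + 1"
  have "R' \<ge> 0" by (simp add: R'_def)
  then have \<rho>: "\<rho> > 0" using c by (simp add: \<rho>_def add_nonneg_pos)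
  \<comment> \<open>The first term preserves half of the coercivity of \<open>C\<close> for the Gram
    matrix; the second keeps the Gram error within half of \<eta> on the ball of radius \<rho>. The
    other half is for the gradient of \<open>g\<close>.\<close>
  define \<delta> where "\<delta> = min (c / 2) (\<eta> / (2 * \<rho>))"
  have \<delta>: "\<delta> > 0" "\<delta> \<le> c / 2" "\<delta> * \<rho> \<le> \<eta> / 2"
  proof -
    show "\<delta> > 0" "\<delta> \<le> c / 2" using c \<eta> \<rho> by (auto simp: \<delta>_def)
    have "\<delta> \<le> \<eta> / (2 * \<rho>)" by (simp add: \<delta>_def)
    then show "\<delta> * \<rho> \<le> \<eta> / 2" using \<rho> by (simp add: field_simps)
  qed
  obtain e0 where e0: "e0 > 0" "\<And>z. norm z < e0 \<Longrightarrow> pattern S v (\<beta> + z) = pattern ?P v z"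
    using pattern_add_small[OF S, of v \<beta>] by metis
  obtain e1 where e1: "e1 > 0" "\<And>b. norm (b - \<beta>) < e1 \<Longrightarrow> norm (G b - G \<beta>) < \<eta> / 2"
    using Gc \<eta> unfolding continuous_on_iff dist_norm by (metis UNIV_I half_gt_zero)
  obtain n0 :: nat where n0: "n0 > 0" "\<And>n. n \<ge> n0 \<Longrightarrow> \<rho> / sqrt n < min e0 e1"
  proof -
    have "(\<lambda>n. \<rho> / sqrt (real n)) \<longlonglongrightarrow> 0"
      by (intro tendsto_divide_0[OF tendsto_const] filterlim_at_top_imp_at_infinity
          filterlim_compose[OF sqrt_at_top filterlim_real_sequentially])
    then have "eventually (\<lambda>n. n > 0 \<and> \<rho> / sqrt (real n) < min e0 e1) sequentially"
      using e0(1) e1(1) by (intro eventually_conj eventually_gt_at_top order_tendstoD(2)) auto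
    then show ?thesis using that by (auto simp: eventually_sequentially)
  qed
  have main: "(\<exists>b. is_arg_min (penalized_ls n (\<lambda>i. x i \<bullet> \<beta> + e i) x (\<lambda>b. sqrt (real n) * f b)) (\<lambda>_. True) b) \<and>
      (\<forall>b. is_arg_min (penalized_ls n (\<lambda>i. x i \<bullet> \<beta> + e i) x (\<lambda>b. sqrt (real n) * f b)) (\<lambda>_. True) b \<longrightarrow>
        (\<exists>w'. norm (w' - w) \<le> \<eta> \<and> optimal_at ?P v C (G \<beta>) (sqrt (real n) *\<^sub>R (b - \<beta>)) w'))"
    if n: "n \<ge> n0" and D: "D = gram n x" and w: "w = score n x e"
      and DC: "\<And>u. norm (D u - C *v u) \<le> \<delta> * norm u" and wR: "norm w \<le> R" for n x e D w
  proof -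
    define r where "r = sqrt (real n)"
    have n1: "n > 0" using n n0(1) by simp
    then have r: "r > 0" by (simp add: r_def)
    let ?F = "penalized_ls n (\<lambda>i. x i \<bullet> \<beta> + e i) x (\<lambda>b. sqrt (real n) * f b)"
    define k0 where "k0 = (\<Sum>i<n. (e i)\<^sup>2) / 2"
    have F: "?F b = k0 + ((r *\<^sub>R (b - \<beta>)) \<bullet> D (r *\<^sub>R (b - \<beta>)) / 2 - w \<bullet> (r *\<^sub>R (b - \<beta>))) + r * f b" for b
      unfolding k0_def r_def by (rule penalized_ls_expand[OF n1 D w])
    have bound: "norm (r *\<^sub>R (b - \<beta>)) < \<rho>" if b: "?F b \<le> ?F \<beta>" for b
    proof -
      define u where "u = r *\<^sub>R (b - \<beta>)"
      have "u \<bullet> D u = u \<bullet> (C *v u) + u \<bullet> (D u - C *v u)" by (simp add: inner_diff_right)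
      moreover have "\<bar>u \<bullet> (D u - C *v u)\<bar> \<le> norm u * (\<delta> * norm u)"
        by (rule order_trans[OF Cauchy_Schwarz_ineq2]) (intro mult_left_mono DC norm_ge_zero)
      moreover have "norm u * (\<delta> * norm u) \<le> c / 2 * (norm u)\<^sup>2"
        using mult_right_mono[OF \<delta>(2), of "(norm u)\<^sup>2"] by (simp add: power2_eq_square algebra_simps)
      ultimately have quad: "c / 2 * (norm u)\<^sup>2 \<le> u \<bullet> D u" using c(2)[of u] by linarith
      have "r * f \<beta> + s \<bullet> u \<le> r * f b"
        using mult_left_mono[OF sub[of b], of r] r by (simp add: u_def algebra_simps)
      moreover have "u \<bullet> D u / 2 - w \<bullet> u + r * f b \<le> r * f \<beta>"
        using b unfolding F u_def[symmetric] by (simp add: D gram_def)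
      ultimately have "u \<bullet> D u / 2 \<le> (w - s) \<bullet> u" by (simp add: inner_diff_left)
      also have "\<dots> \<le> norm (w - s) * norm u" by (rule norm_cauchy_schwarz)
      also have "\<dots> \<le> R' * norm u"
        using wR norm_triangle_ineq4[of w s] by (intro mult_right_mono) (auto simp: R'_def)
      finally have "c / 2 * (norm u)\<^sup>2 \<le> 2 * R' * norm u" using quad by linarith
      then have "norm u = 0 \<or> c / 2 * norm u \<le> 2 * R'"
        by (auto simp: power2_eq_square mult.assoc[symmetric] mult_le_cancel_right)
      then have "norm u \<le> 2 * R' * 2 / c"
        using c(1) \<open>R' \<ge> 0\<close> by (auto simp: field_simps)
      then show ?thesis by (simp add: \<rho>_def u_def)
    qed
    \<comment> \<open>A minimizer over the compact ball is global, because any point at least as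
      good as \<beta> satisfies \<open>bound\<close> and lies in that ball.\<close>
    have "\<exists>b. is_arg_min ?F (\<lambda>_. True) b"
    proof -
      have gc: "continuous_on UNIV g"
        using G by (intro continuous_at_imp_continuous_on)
          (auto simp: gderiv_def intro: has_derivative_continuous)
      have fc: "continuous_on UNIV f"
        unfolding feq[abs_def] by (intro continuous_on_add continuous_on_max_inner S gc)
      have "continuous_on UNIV ?F"
        unfolding penalized_ls_def L2_set_def by (intro continuous_intros fc) auto
      then have "continuous_on (cball \<beta> (\<rho> / r)) ?F" by (rule continuous_on_subset) simp
      moreover have "cball \<beta> (\<rho> / r) \<noteq> {}"
        unfolding cball_eq_empty using divide_pos_pos[OF \<rho> r] by linarith
      ultimately obtain b where b: "b \<in> cball \<beta> (\<rho> / r)" "\<And>z. z \<in> cball \<beta> (\<rho> / r) \<Longrightarrow> ?F b \<le> ?F z"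
        using continuous_attains_inf[OF compact_cball] by blast
      have b\<beta>: "?F b \<le> ?F \<beta>" using \<rho> r by (intro b(2)) simp
      have "?F b \<le> ?F z" for z
      proof (cases "?F z \<le> ?F \<beta>")
        case True
        then have "r * norm (z - \<beta>) < \<rho>" using bound[OF True] r by simp
        then show ?thesis
          using r by (intro b(2)) (simp add: dist_norm norm_minus_commute field_simps)
      qed (use b\<beta> in linarith)
      then show ?thesis by (auto simp: is_arg_min_linorder)
    qed
    moreover have "\<exists>w'. norm (w' - w) \<le> \<eta> \<and> optimal_at ?P v C (G \<beta>) (sqrt (real n) *\<^sub>R (b - \<beta>)) w'"
      if b: "is_arg_min ?F (\<lambda>_. True) b" for b
    proof -
      have bmin: "?F b \<le> ?F z" for z using b by (auto simp: is_arg_min_linorder)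
      define u where "u = r *\<^sub>R (b - \<beta>)"
      have u: "norm u < \<rho>" using bound[OF bmin] by (simp add: u_def)
      have bu: "b = \<beta> + (1 / r) *\<^sub>R u" using r by (simp add: u_def)
      have small: "norm ((1 / r) *\<^sub>R u) < min e0 e1"
      proof -
        have "norm ((1 / r) *\<^sub>R u) = norm u / r" using r by simp
        also have "\<dots> < \<rho> / r" using u r by (simp add: divide_strict_right_mono)
        also have "\<dots> < min e0 e1" using n0(2)[OF n] by (simp add: r_def)
        finally show ?thesis .
      qed
      \<comment> \<open>Smallness of \<open>b - \<beta>\<close> reduces to the indices active at
        \<beta>, and positive scaling replaces \<open>b - \<beta>\<close> by
        \<open>u\<close>.\<close>
      have pat: "pattern S v b = pattern ?P v u"
        unfolding bu using e0(2)[of "(1 / r) *\<^sub>R u"] small r by (simp add: pattern_scaleR)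
      \<comment> \<open>Dividing the objective by \<open>r\<close> gives the maximum of linear forms
        weight one, as Fermat's rule requires; the least squares part then has gradient
        \<open>D u - w\<close>.\<close>
      let ?q = "\<lambda>b. (\<Sum>i<n. (e i - x i \<bullet> (b - \<beta>))\<^sup>2) / (2 * r)"
      have Fq: "?F z = r * (max_inner S v z + (?q z + g z))" for z
      proof -
        have "(L2_set (\<lambda>i. x i \<bullet> \<beta> + e i - x i \<bullet> z) {..<n})\<^sup>2 = (\<Sum>i<n. (e i - x i \<bullet> (z - \<beta>))\<^sup>2)"
          by (simp add: L2_set_def sum_nonneg inner_diff_right algebra_simps)
        then show ?thesis
          using r unfolding penalized_ls_def r_def[symmetric] by (simp add: feq field_simps)
      qed
      have "GDERIV ?q b :> D u - w"
      proof -
        have "(?q has_derivative (\<lambda>h. (\<Sum>i<n. 2 * (e i - x i \<bullet> (b - \<beta>)) * (- (x i \<bullet> h))) / (2 * r))) (at b)"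
          using r by (auto intro!: derivative_eq_intros simp: algebra_simps)
        moreover have "(\<Sum>i<n. 2 * (e i - x i \<bullet> (b - \<beta>)) * (- (x i \<bullet> h))) / (2 * r) = h \<bullet> (D u - w)" for h
        proof -
          have rr: "real n = r * r" by (simp add: r_def)
          have "h \<bullet> (D u - w) = (\<Sum>i<n. (x i \<bullet> (b - \<beta>)) * (x i \<bullet> h)) / r - (\<Sum>i<n. e i * (x i \<bullet> h)) / r"
            unfolding D w gram_def score_def r_def[symmetric] rr
            using r by (simp add: u_def inner_diff_right inner_sum_right sum_distrib_left sum_divide_distrib
                inner_commute[of h] mult.assoc)
          also have "\<dots> = (\<Sum>i<n. ((x i \<bullet> (b - \<beta>)) * (x i \<bullet> h) - e i * (x i \<bullet> h)) / r)"
            by (simp only: sum_subtractf diff_divide_distrib sum_divide_distrib)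
          also have "\<dots> = (\<Sum>i<n. 2 * (e i - x i \<bullet> (b - \<beta>)) * (- (x i \<bullet> h)) / (2 * r))"
            using r by (intro sum.cong) (simp_all add: field_simps)
          also have "\<dots> = (\<Sum>i<n. 2 * (e i - x i \<bullet> (b - \<beta>)) * (- (x i \<bullet> h))) / (2 * r)"
            by (simp only: sum_divide_distrib)
          finally show ?thesis ..
        qed
        ultimately show ?thesis by (simp add: gderiv_def)
      qed
      then have "GDERIV (\<lambda>z. ?q z + g z) b :> (D u - w) + G b"
        by (intro GDERIV_add G)
      moreover have "max_inner S v b + (?q b + g b) \<le> max_inner S v z + (?q z + g z)" for z
        using bmin[of z] r unfolding Fq by simp
      ultimately have "- ((D u - w) + G b) \<in> convex hull (v ` pattern S v b)"
        by (rule minimizer_gradient_in_hull[OF S])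
      then have hull: "- ((D u - w) + G b) \<in> convex hull (v ` pattern ?P v u)" by (simp add: pat)
      \<comment> \<open>Chosen so that \<open>w' - C *v u - G \<beta>\<close> is the element of the
        hull just found: the Gram error and the variation of the gradient count as noise.\<close>
      define w' where "w' = w - (D u - C *v u) - (G b - G \<beta>)"
      have "norm (w' - w) \<le> norm (D u - C *v u) + norm (G b - G \<beta>)"
        unfolding w'_def using norm_triangle_ineq4[of "- (D u - C *v u)" "G b - G \<beta>"]
        by (simp add: norm_minus_commute algebra_simps)
      also have "norm (D u - C *v u) \<le> \<eta> / 2"
        using DC[of u] mult_left_mono[of "norm u" \<rho> \<delta>] u \<delta> by linarith
      also have "norm (G b - G \<beta>) \<le> \<eta> / 2"
        using e1(2)[of b] small unfolding bu by simp
      finally have "norm (w' - w) \<le> \<eta>" by simp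
      moreover have "optimal_at ?P v C (G \<beta>) u w'"
        using hull by (simp add: optimal_at_def w'_def algebra_simps)
      ultimately show ?thesis unfolding u_def r_def by blast
    qed
    ultimately show ?thesis by blast
  qed
  show ?thesis
    by (rule that[OF \<delta>(1) n0(1)]) (intro allI impI main[OF _ refl refl], auto)
qed

section \<open>Law of large numbers and central limit theorem\<close>

text \<open>Independence and zero means cancel the cross terms; the \<open>n\<close> diagonal terms
  remain.\<close>

lemma (in prob_space) expectation_sum_square_le:
  fixes Y :: "nat \<Rightarrow> 'a \<Rightarrow> real"
  assumes ind: "indep_vars (\<lambda>_. borel) Y UNIV" and mean: "\<And>i. expectation (Y i) = 0"
    and bound: "\<And>i \<omega>. \<bar>Y i \<omega>\<bar> \<le> B"
  shows "integrable M (\<lambda>\<omega>. (\<Sum>i<n. Y i \<omega>)\<^sup>2)" "expectation (\<lambda>\<omega>. (\<Sum>i<n. Y i \<omega>)\<^sup>2) \<le> real n * B\<^sup>2"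
proof -
  have [measurable]: "Y i \<in> borel_measurable M" for i
    using ind by (simp add: indep_vars_def)
  have int: "integrable M (Y i)" for i
    using bound by (intro integrable_const_bound[where B=B]) auto
  have B: "B \<ge> 0" using bound[of undefined undefined] by linarith
  have int2: "integrable M (\<lambda>\<omega>. Y i \<omega> * Y j \<omega>)" for i j
    using bound B by (intro integrable_const_bound[where B="B * B"]) (auto simp: abs_mult intro!: mult_mono)
  have cross: "expectation (\<lambda>\<omega>. Y i \<omega> * Y j \<omega>) = 0" if "i \<noteq> j" for i j
    using indep_vars_lebesgue_integral[of "{i, j}" Y] indep_vars_subset[OF ind, of "{i, j}"] int mean that
    by simp
  have eq: "(\<Sum>i<n. Y i \<omega>)\<^sup>2 = (\<Sum>i<n. \<Sum>j<n. Y i \<omega> * Y j \<omega>)" for \<omega>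
    by (simp add: power2_eq_square sum_product)
  show "integrable M (\<lambda>\<omega>. (\<Sum>i<n. Y i \<omega>)\<^sup>2)" unfolding eq using int2 by simp
  have "expectation (\<lambda>\<omega>. (\<Sum>i<n. Y i \<omega>)\<^sup>2) = (\<Sum>i<n. \<Sum>j<n. expectation (\<lambda>\<omega>. Y i \<omega> * Y j \<omega>))"
    unfolding eq using int2 by simp
  also have "\<dots> = (\<Sum>i<n. \<Sum>j<n. if j = i then expectation (\<lambda>\<omega>. Y i \<omega> * Y i \<omega>) else 0)"
    using cross by (intro sum.cong) auto
  also have "\<dots> = (\<Sum>i<n. expectation (\<lambda>\<omega>. Y i \<omega> * Y i \<omega>))"
    by (intro sum.cong) (auto simp: sum.delta)
  also have "\<dots> \<le> (\<Sum>i<n. B\<^sup>2)"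
  proof (rule sum_mono)
    fix i
    have "Y i \<omega> * Y i \<omega> \<le> B\<^sup>2" for \<omega>
      using bound[of i \<omega>] by (metis abs_le_square_iff abs_of_nonneg B power2_eq_square)
    then have "expectation (\<lambda>\<omega>. Y i \<omega> * Y i \<omega>) \<le> expectation (\<lambda>_. B\<^sup>2)"
      by (intro integral_mono int2) auto
    then show "expectation (\<lambda>\<omega>. Y i \<omega> * Y i \<omega>) \<le> B\<^sup>2" by (simp add: prob_space)
  qed
  finally show "expectation (\<lambda>\<omega>. (\<Sum>i<n. Y i \<omega>)\<^sup>2) \<le> real n * B\<^sup>2" by simp
qed

text \<open>For the entries of the Gram matrix only a first moment is available, so Chebyshev's
  inequality is applied to variables truncated at a level \<open>k\<close>. That level is fixed in
  advance by the mean truncation error \<open>a k\<close>, and then \<open>n\<close> grows.\<close>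

lemma (in prob_space) weak_law_of_large_numbers:
  fixes Z :: "nat \<Rightarrow> 'a \<Rightarrow> real"
  assumes ind: "indep_vars (\<lambda>_. borel) Z UNIV" and ident: "\<And>i j. distr M borel (Z i) = distr M borel (Z j)"
    and int: "integrable M (Z 0)" and \<delta>: "\<delta> > 0"
  shows "(\<lambda>n. prob {\<omega>\<in>space M. \<delta> \<le> \<bar>(\<Sum>i<n. Z i \<omega>) / real n - expectation (Z 0)\<bar>}) \<longlonglongrightarrow> 0"
proof -
  have Zm [measurable]: "Z i \<in> borel_measurable M" for i
    using ind by (simp add: indep_vars_def)
  have same: "expectation (\<lambda>\<omega>. h (Z i \<omega>)) = expectation (\<lambda>\<omega>. h (Z 0 \<omega>))"
    "integrable M (\<lambda>\<omega>. h (Z i \<omega>)) \<longleftrightarrow> integrable M (\<lambda>\<omega>. h (Z 0 \<omega>))"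
    if [measurable]: "h \<in> borel_measurable borel" for h :: "real \<Rightarrow> real" and i
  proof -
    show "expectation (\<lambda>\<omega>. h (Z i \<omega>)) = expectation (\<lambda>\<omega>. h (Z 0 \<omega>))"
      using integral_distr[OF Zm[of i] that] integral_distr[OF Zm[of 0] that] ident[of i 0] by simp
    show "integrable M (\<lambda>\<omega>. h (Z i \<omega>)) \<longleftrightarrow> integrable M (\<lambda>\<omega>. h (Z 0 \<omega>))"
      using integrable_distr_eq[OF Zm[of i] that] integrable_distr_eq[OF Zm[of 0] that] ident[of i 0] by simp
  qed
  define T where "T k x = max (- real k) (min (real k) x)" for k x
  have [measurable]: "T k \<in> borel_measurable borel" for k unfolding T_def by measurable
  have T_bound: "\<bar>T k x\<bar> \<le> real k" "\<bar>x - T k x\<bar> \<le> \<bar>x\<bar>" for k x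
    by (auto simp: T_def)
  have T_eq: "T k x = x" if "\<bar>x\<bar> \<le> real k" for k x using that by (auto simp: T_def)
  define a where "a k = expectation (\<lambda>\<omega>. \<bar>Z 0 \<omega> - T k (Z 0 \<omega>)\<bar>)" for k
  define m where "m k = expectation (\<lambda>\<omega>. T k (Z 0 \<omega>))" for k
  have int_T: "integrable M (\<lambda>\<omega>. T k (Z i \<omega>))" for k i
    using T_bound by (intro integrable_const_bound[where B="real k"]) auto
  have int_diff: "integrable M (\<lambda>\<omega>. \<bar>Z i \<omega> - T k (Z i \<omega>)\<bar>)" for k i
    using same(2)[of "\<lambda>x. \<bar>x - T k x\<bar>" i] int int_T[of k 0] by simp
  have "a \<longlonglongrightarrow> expectation (\<lambda>\<omega>. 0)"
    unfolding a_def
  proof (rule integral_dominated_convergence[where w="\<lambda>\<omega>. \<bar>Z 0 \<omega>\<bar>"])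
    show "AE \<omega> in M. (\<lambda>k. \<bar>Z 0 \<omega> - T k (Z 0 \<omega>)\<bar>) \<longlonglongrightarrow> 0"
    proof (rule AE_I2)
      fix \<omega>
      obtain K where "\<bar>Z 0 \<omega>\<bar> \<le> real K" using real_arch_simple by blast
      then have "eventually (\<lambda>k. \<bar>Z 0 \<omega> - T k (Z 0 \<omega>)\<bar> = 0) sequentially"
        by (intro eventually_sequentiallyI[of K]) (auto simp: T_eq)
      then show "(\<lambda>k. \<bar>Z 0 \<omega> - T k (Z 0 \<omega>)\<bar>) \<longlonglongrightarrow> 0" by (rule tendsto_eventually)
    qed
  qed (use int T_bound in auto)
  then have a0: "a \<longlonglongrightarrow> 0" by simp
  have ma: "\<bar>m k - expectation (Z 0)\<bar> \<le> a k" for k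
  proof -
    have "\<bar>expectation (Z 0) - m k\<bar> = \<bar>expectation (\<lambda>\<omega>. Z 0 \<omega> - T k (Z 0 \<omega>))\<bar>"
      using int int_T[of k 0] by (simp add: m_def)
    also have "\<dots> \<le> a k" unfolding a_def by (rule integral_abs_bound)
    finally show ?thesis by (simp add: abs_minus_commute)
  qed
  let ?bad = "\<lambda>n. {\<omega>\<in>space M. \<delta> \<le> \<bar>(\<Sum>i<n. Z i \<omega>) / real n - expectation (Z 0)\<bar>}"
  \<comment> \<open>The deviation splits into the sampled truncation error (Markov), the centred
    truncated average (Chebyshev) and a deterministic bias of at most \<open>a k\<close>, each
    allowed a third of \<delta>. The constant 36 is \<open>3\<^sup>2\<close> from that third times
    \<open>2\<^sup>2\<close> from the bound \<open>2 * real k\<close> on \<open>Y\<close>.\<close>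
  have main: "prob (?bad n) \<le> 3 * a k / \<delta> + 36 * (real k)\<^sup>2 / (real n * \<delta>\<^sup>2)" if n: "n > 0" and ak: "a k < \<delta> / 3" for n k
  proof -
    let ?A = "\<lambda>\<omega>. (\<Sum>i<n. \<bar>Z i \<omega> - T k (Z i \<omega>)\<bar>)"
    define Y where "Y i \<omega> = T k (Z i \<omega>) - m k" for i \<omega>
    have [measurable]: "Y i \<in> borel_measurable M" for i unfolding Y_def by measurable
    have Y_ind: "indep_vars (\<lambda>_. borel) Y UNIV"
      unfolding Y_def by (rule indep_vars_compose2[OF ind]) measurable
    have Y_mean: "expectation (Y i) = 0" for i
      unfolding Y_def using int_T[of k i] same(1)[of "T k" i] by (simp add: m_def prob_space)
    have mk: "\<bar>m k\<bar> \<le> real k"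
    proof -
      have "\<bar>m k\<bar> \<le> expectation (\<lambda>\<omega>. \<bar>T k (Z 0 \<omega>)\<bar>)" unfolding m_def by (rule integral_abs_bound)
      also have "\<dots> \<le> expectation (\<lambda>\<omega>. real k)"
        using T_bound int_T by (intro integral_mono) auto
      finally show ?thesis by (simp add: prob_space)
    qed
    have Y_bound: "\<bar>Y i \<omega>\<bar> \<le> 2 * real k" for i \<omega>
      unfolding Y_def using T_bound(1)[of k "Z i \<omega>"] mk by linarith
    note Ysq = expectation_sum_square_le[OF Y_ind Y_mean Y_bound, of n]
    have P1: "prob {\<omega>\<in>space M. real n * \<delta> / 3 \<le> ?A \<omega>} \<le> 3 * a k / \<delta>"
    proof -
      have "prob {\<omega>\<in>space M. real n * \<delta> / 3 \<le> ?A \<omega>} \<le> expectation ?A / (real n * \<delta> / 3)"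
        using n \<delta> int_diff by (intro integral_Markov_inequality_measure[where A="{}"]) (auto intro!: sum_nonneg)
      also have "expectation ?A = (\<Sum>i<n. expectation (\<lambda>\<omega>. \<bar>Z i \<omega> - T k (Z i \<omega>)\<bar>))"
        using int_diff by simp
      also have "\<dots> = (\<Sum>i<n. a k)"
        unfolding a_def by (intro sum.cong same(1)[of "\<lambda>x. \<bar>x - T k x\<bar>"]) auto
      finally show ?thesis using n by (simp add: field_simps)
    qed
    have P2: "prob {\<omega>\<in>space M. (real n * \<delta> / 3)\<^sup>2 \<le> (\<Sum>i<n. Y i \<omega>)\<^sup>2} \<le> 36 * (real k)\<^sup>2 / (real n * \<delta>\<^sup>2)"
    proof -
      have "prob {\<omega>\<in>space M. (real n * \<delta> / 3)\<^sup>2 \<le> (\<Sum>i<n. Y i \<omega>)\<^sup>2} \<le>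
          expectation (\<lambda>\<omega>. (\<Sum>i<n. Y i \<omega>)\<^sup>2) / (real n * \<delta> / 3)\<^sup>2"
        using n \<delta> Ysq(1) by (intro integral_Markov_inequality_measure[where A="{}"]) auto
      also have "\<dots> \<le> (real n * (2 * real k)\<^sup>2) / (real n * \<delta> / 3)\<^sup>2"
        by (intro divide_right_mono Ysq(2)) simp
      also have "\<dots> = 36 * (real k)\<^sup>2 / (real n * \<delta>\<^sup>2)"
        using n \<delta> by (simp add: power2_eq_square field_simps)
      finally show ?thesis .
    qed
    have "?bad n \<subseteq> {\<omega>\<in>space M. real n * \<delta> / 3 \<le> ?A \<omega>} \<union> {\<omega>\<in>space M. (real n * \<delta> / 3)\<^sup>2 \<le> (\<Sum>i<n. Y i \<omega>)\<^sup>2}"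
    proof (rule subsetI, rule ccontr)
      fix \<omega> assume bad: "\<omega> \<in> ?bad n"
        and "\<omega> \<notin> {\<omega>\<in>space M. real n * \<delta> / 3 \<le> ?A \<omega>} \<union> {\<omega>\<in>space M. (real n * \<delta> / 3)\<^sup>2 \<le> (\<Sum>i<n. Y i \<omega>)\<^sup>2}"
      then have 1: "?A \<omega> < real n * \<delta> / 3" and 2: "(\<Sum>i<n. Y i \<omega>)\<^sup>2 < (real n * \<delta> / 3)\<^sup>2" by auto
      have 3: "\<bar>\<Sum>i<n. Y i \<omega>\<bar> < real n * \<delta> / 3"
        by (rule power2_less_imp_less) (use 2 \<delta> in simp_all)
      have "(\<Sum>i<n. Z i \<omega>) - real n * expectation (Z 0) =
          (\<Sum>i<n. Z i \<omega> - T k (Z i \<omega>)) + (\<Sum>i<n. Y i \<omega>) + real n * (m k - expectation (Z 0))"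
        by (simp add: Y_def sum_subtractf algebra_simps)
      moreover have "\<bar>\<Sum>i<n. Z i \<omega> - T k (Z i \<omega>)\<bar> \<le> ?A \<omega>" by (rule sum_abs)
      moreover have "\<bar>real n * (m k - expectation (Z 0))\<bar> \<le> real n * (\<delta> / 3)"
        unfolding abs_mult using ma[of k] ak by (intro mult_mono) auto
      ultimately have "\<bar>(\<Sum>i<n. Z i \<omega>) - real n * expectation (Z 0)\<bar> < real n * \<delta>"
        using 1 3 by linarith
      moreover have "real n * \<bar>(\<Sum>i<n. Z i \<omega>) / real n - expectation (Z 0)\<bar>
          = \<bar>(\<Sum>i<n. Z i \<omega>) - real n * expectation (Z 0)\<bar>"
      proof -
        have "real n * ((\<Sum>i<n. Z i \<omega>) / real n - expectation (Z 0)) = (\<Sum>i<n. Z i \<omega>) - real n * expectation (Z 0)"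
          using n by (simp add: field_simps)
        then show ?thesis by (metis abs_mult abs_of_nat)
      qed
      ultimately have "\<bar>(\<Sum>i<n. Z i \<omega>) / real n - expectation (Z 0)\<bar> < \<delta>"
        using n by (metis mult_less_cancel_left_pos of_nat_0_less_iff)
      with bad show False by simp
    qed
    then have "prob (?bad n) \<le> prob ({\<omega>\<in>space M. real n * \<delta> / 3 \<le> ?A \<omega>} \<union> {\<omega>\<in>space M. (real n * \<delta> / 3)\<^sup>2 \<le> (\<Sum>i<n. Y i \<omega>)\<^sup>2})"
      by (intro finite_measure_mono) auto
    also have "\<dots> \<le> prob {\<omega>\<in>space M. real n * \<delta> / 3 \<le> ?A \<omega>} + prob {\<omega>\<in>space M. (real n * \<delta> / 3)\<^sup>2 \<le> (\<Sum>i<n. Y i \<omega>)\<^sup>2}"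
      by (intro measure_Un_le) auto
    finally show ?thesis using P1 P2 by simp
  qed
  show ?thesis
  proof (rule LIMSEQ_I)
    fix \<eta> :: real assume \<eta>: "\<eta> > 0"
    have "eventually (\<lambda>k. a k < min (\<delta> / 3) (\<delta> * \<eta> / 6)) sequentially"
      by (rule order_tendstoD(2)[OF a0]) (use \<delta> \<eta> in auto)
    then obtain k where k: "a k < \<delta> / 3" "a k < \<delta> * \<eta> / 6" by (auto simp: eventually_sequentially)
    have "(\<lambda>n. (36 * (real k)\<^sup>2 / \<delta>\<^sup>2) * inverse (real n)) \<longlonglongrightarrow> (36 * (real k)\<^sup>2 / \<delta>\<^sup>2) * 0"
      by (intro tendsto_mult_left lim_inverse_n)
    then have "eventually (\<lambda>n. (36 * (real k)\<^sup>2 / \<delta>\<^sup>2) * inverse (real n) < \<eta> / 2 \<and> n > 0) sequentially"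
      using \<eta> by (intro eventually_conj order_tendstoD(2) eventually_gt_at_top) auto
    then obtain n0 where n0: "\<And>n. n \<ge> n0 \<Longrightarrow> (36 * (real k)\<^sup>2 / \<delta>\<^sup>2) * inverse (real n) < \<eta> / 2 \<and> n > 0"
      by (auto simp: eventually_sequentially)
    have "norm (prob (?bad n) - 0) < \<eta>" if "n \<ge> n0" for n
    proof -
      have "3 * a k / \<delta> < \<eta> / 2" using k(2) \<delta> by (simp add: field_simps)
      moreover have "36 * (real k)\<^sup>2 / (real n * \<delta>\<^sup>2) < \<eta> / 2"
        using n0[OF that] by (simp add: field_simps)
      ultimately show ?thesis using main[of n k] n0[OF that] k(1) by simp
    qed
    then show "\<exists>n0. \<forall>n\<ge>n0. norm (prob (?bad n) - 0) < \<eta>" by blast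
  qed
qed

text \<open>The sigma algebras generated by \<open>Y1\<close> and \<open>Y2\<close> are contained in
  those of \<open>V1\<close> and \<open>V2\<close>. This brings the independence of two whole
  sequences down to single functions of them.\<close>

lemma (in prob_space) indep_set_imp_indep_var:
  assumes ind: "indep_set (sets V1) (sets V2)" and sp: "space V1 = space M" "space V2 = space M"
    and Y: "Y1 \<in> measurable V1 N" "Y2 \<in> measurable V2 N"
  shows "indep_var N Y1 N Y2"
proof -
  have ev: "sets V1 \<subseteq> events" "sets V2 \<subseteq> events"
    and prod: "\<And>a b. a \<in> sets V1 \<Longrightarrow> b \<in> sets V2 \<Longrightarrow> prob (a \<inter> b) = prob a * prob b"
    using ind unfolding indep_sets2_eq by blast+
  have sub: "sigma_sets (space M) {Y -` A \<inter> space M |A. A \<in> sets N} \<subseteq> sets V"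
    if "Y \<in> measurable V N" "space V = space M" for Y V
    unfolding that(2)[symmetric]
    by (rule sets.sigma_sets_subset) (use measurable_sets[OF that(1)] in blast)
  have "random_variable N Y1" "random_variable N Y2"
    using Y ev sp unfolding measurable_def by auto
  moreover have "indep_set (sigma_sets (space M) {Y1 -` A \<inter> space M |A. A \<in> sets N})
      (sigma_sets (space M) {Y2 -` A \<inter> space M |A. A \<in> sets N})"
    using sub[OF Y(1) sp(1)] sub[OF Y(2) sp(2)] ev prod by (intro indep_setI) blast+
  ultimately show ?thesis by (simp add: indep_var_eq)
qed

lemma borel_measurable_vec_component [measurable (raw)]:
  fixes f :: "'a \<Rightarrow> real^'n"
  assumes "f \<in> borel_measurable N"
  shows "(\<lambda>x. f x $ j) \<in> borel_measurable N"
  by (rule measurable_compose[OF assms]) (intro borel_measurable_continuous_onI continuous_intros)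

section \<open>Moments, score and Gram matrix in the linear model\<close>

context linear_model
begin

lemma X_measurable [measurable]: "X i \<in> borel_measurable M"
  using X_indep by (simp add: indep_vars_def)

lemma \<epsilon>_measurable [measurable]: "\<epsilon> i \<in> borel_measurable M"
  using \<epsilon>_indep by (simp add: indep_vars_def)

lemma X_norm_integrable: "integrable M (\<lambda>\<omega>. norm (X i \<omega>))"
  by (rule square_integrable_imp_integrable[OF _ X_square_integrable]) measurable

lemma X_integrable: "integrable M (X i)"
  using X_norm_integrable[of i] by (subst (asm) integrable_norm_iff) auto

lemma X_inner_integrable: "integrable M (\<lambda>\<omega>. t \<bullet> X i \<omega>)"
  using X_integrable by simp

lemma X_inner_centered: "expectation (\<lambda>\<omega>. t \<bullet> X i \<omega>) = 0"
  using X_integrable X_centered by simp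

lemma X_nth_centered: "expectation (\<lambda>\<omega>. X i \<omega> $ j) = 0"
  using X_inner_centered[of "axis j 1" i] by (simp add: inner_axis')

lemma X_nth_mult_integrable: "integrable M (\<lambda>\<omega>. X i \<omega> $ j * X i \<omega> $ k)"
proof (rule Bochner_Integration.integrable_bound[OF X_square_integrable[of i]])
  show "AE \<omega> in M. norm (X i \<omega> $ j * X i \<omega> $ k) \<le> norm ((norm (X i \<omega>))\<^sup>2)"
    by (intro AE_I2) (auto simp: abs_mult power2_eq_square intro!: mult_mono component_le_norm_cart)
qed measurable

lemma X_nth_mult_expectation: "expectation (\<lambda>\<omega>. X i \<omega> $ j * X i \<omega> $ k) = C $ j $ k"
  using X_covariance[of i] by (auto simp: covariance_matrix_def X_nth_centered vec_eq_iff)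

lemma X_inner_square: "(t \<bullet> X i \<omega>)\<^sup>2 = (\<Sum>j\<in>UNIV. \<Sum>k\<in>UNIV. t $ j * t $ k * (X i \<omega> $ j * X i \<omega> $ k))"
  by (simp add: inner_vec_def power2_eq_square sum_product algebra_simps)

lemma X_inner_square_integrable: "integrable M (\<lambda>\<omega>. (t \<bullet> X i \<omega>)\<^sup>2)"
  unfolding X_inner_square using X_nth_mult_integrable by simp

lemma X_inner_variance: "expectation (\<lambda>\<omega>. (t \<bullet> X i \<omega>)\<^sup>2) = t \<bullet> (C *v t)"
  unfolding X_inner_square using X_nth_mult_integrable
  by (simp add: X_nth_mult_expectation inner_vec_def matrix_vector_mult_def sum_distrib_left algebra_simps)

lemma \<epsilon>_second_moment: "expectation (\<lambda>\<omega>. (\<epsilon> i \<omega>)\<^sup>2) = \<sigma>\<^sup>2"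
  using \<epsilon>_variance[of i] \<epsilon>_centered[of i] by simp

lemma \<epsilon>_integrable: "integrable M (\<epsilon> i)"
  by (rule square_integrable_imp_integrable[OF _ \<epsilon>_square_integrable]) measurable

lemma X_\<epsilon>_inner_indep: "indep_var borel (\<lambda>\<omega>. t \<bullet> X i \<omega>) borel (\<epsilon> i)"
proof (rule indep_set_imp_indep_var[OF X_\<epsilon>_indep])
  let ?V = "vimage_algebra (space M) (\<lambda>\<omega> i. X i \<omega>) (Pi\<^sub>M UNIV (\<lambda>_. borel))"
  have "(\<lambda>\<omega> i. X i \<omega>) \<in> measurable ?V (Pi\<^sub>M UNIV (\<lambda>_. borel))"
    by (rule measurable_vimage_algebra1) (auto simp: space_PiM)
  from measurable_compose[OF this measurable_component_singleton[of i]]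
  have [measurable]: "X i \<in> measurable ?V borel" by simp
  show "(\<lambda>\<omega>. t \<bullet> X i \<omega>) \<in> borel_measurable ?V" by measurable
  let ?V' = "vimage_algebra (space M) (\<lambda>\<omega> i. \<epsilon> i \<omega>) (Pi\<^sub>M UNIV (\<lambda>_. borel))"
  have "(\<lambda>\<omega> i. \<epsilon> i \<omega>) \<in> measurable ?V' (Pi\<^sub>M UNIV (\<lambda>_. borel))"
    by (rule measurable_vimage_algebra1) (auto simp: space_PiM)
  from measurable_compose[OF this measurable_component_singleton[of i]]
  show "\<epsilon> i \<in> borel_measurable ?V'" by simp
qed simp_all

text \<open>Joint independence of the pairs of design vector and noise has to be assembled from
  independence within each sequence and between the sequences. The rectangles \<open>E i\<close>
  form an intersection-stable generator; for finitely many of them the design part separates from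
  the noise part, each part factors over the indices, and the factors are regrouped by
  index.\<close>

lemma score_indep: "indep_vars (\<lambda>_. borel) (\<lambda>i \<omega>. (t \<bullet> X i \<omega>) * \<epsilon> i \<omega>) UNIV"
proof -
  define E where "E i = {X i -` A \<inter> \<epsilon> i -` B \<inter> space M | A B. A \<in> sets borel \<and> B \<in> sets borel}" for i
  have E_I: "X i -` A \<inter> \<epsilon> i -` B \<inter> space M \<in> E i" if "A \<in> sets borel" "B \<in> sets borel" for i A B
    unfolding E_def mem_Collect_eq by (rule exI[of _ A], rule exI[of _ B]) (simp add: that)
  have stable: "Int_stable (E i)" for i
  proof (rule Int_stableI)
    fix a b assume "a \<in> E i" "b \<in> E i"
    then obtain A B A' B' where ab: "a = X i -` A \<inter> \<epsilon> i -` B \<inter> space M" "b = X i -` A' \<inter> \<epsilon> i -` B' \<inter> space M"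
      and s: "A \<in> sets borel" "B \<in> sets borel" "A' \<in> sets borel" "B' \<in> sets borel"
      unfolding E_def by blast
    have "a \<inter> b = X i -` (A \<inter> A') \<inter> \<epsilon> i -` (B \<inter> B') \<inter> space M" using ab by auto
    also have "\<dots> \<in> E i" using s by (intro E_I) auto
    finally show "a \<inter> b \<in> E i" .
  qed
  have "indep_sets E UNIV"
  proof (rule indep_setsI)
    show "E i \<subseteq> events" for i
    proof
      fix a assume "a \<in> E i"
      then obtain A B where ab: "a = (X i -` A \<inter> space M) \<inter> (\<epsilon> i -` B \<inter> space M)" "A \<in> sets borel" "B \<in> sets borel"
        unfolding E_def by blast
      then show "a \<in> events" by (auto intro!: sets.Int measurable_sets)
    qed
    fix a and J :: "nat set" assume J: "J \<noteq> {}" "finite J" and a: "\<forall>j\<in>J. a j \<in> E j"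
    then have "\<forall>j\<in>J. \<exists>A B. a j = X j -` A \<inter> \<epsilon> j -` B \<inter> space M \<and> A \<in> sets borel \<and> B \<in> sets borel"
      unfolding E_def by blast
    then obtain A B where aAB: "\<And>j. j \<in> J \<Longrightarrow> a j = X j -` A j \<inter> \<epsilon> j -` B j \<inter> space M"
      and A: "\<And>j. j \<in> J \<Longrightarrow> A j \<in> sets borel" and B: "\<And>j. j \<in> J \<Longrightarrow> B j \<in> sets borel"
      by metis
    \<comment> \<open>Cylinder sets over \<open>J\<close> are measurable in the infinite product,
      which puts events about finitely many coordinates into the sigma algebras of the independence
      assumption.\<close>
    have box: "{f. \<forall>j\<in>J. f j \<in> D j} \<in> sets (Pi\<^sub>M UNIV (\<lambda>_. borel))"
      if D: "\<And>j. j \<in> J \<Longrightarrow> D j \<in> sets borel" for D :: "nat \<Rightarrow> 'c::topological_space set"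
    proof -
      have "{f. \<forall>j\<in>J. f j \<in> D j} = prod_emb UNIV (\<lambda>_. borel) J (Pi\<^sub>E J D)"
        by (auto simp: prod_emb_def space_PiM PiE_iff restrict_def extensional_def)
      then show ?thesis using D J by (auto intro!: sets_PiM_I)
    qed
    let ?a = "\<Inter>j\<in>J. X j -` A j \<inter> space M" and ?b = "\<Inter>j\<in>J. \<epsilon> j -` B j \<inter> space M"
    have a': "?a \<in> sets (vimage_algebra (space M) (\<lambda>\<omega> i. X i \<omega>) (Pi\<^sub>M UNIV (\<lambda>_. borel)))"
    proof -
      have "?a = (\<lambda>\<omega> i. X i \<omega>) -` {f. \<forall>j\<in>J. f j \<in> A j} \<inter> space M" using J by auto
      then show ?thesis by (simp only:) (intro in_vimage_algebra box A)
    qed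
    have b': "?b \<in> sets (vimage_algebra (space M) (\<lambda>\<omega> i. \<epsilon> i \<omega>) (Pi\<^sub>M UNIV (\<lambda>_. borel)))"
    proof -
      have "?b = (\<lambda>\<omega> i. \<epsilon> i \<omega>) -` {f. \<forall>j\<in>J. f j \<in> B j} \<inter> space M" using J by auto
      then show ?thesis by (simp only:) (intro in_vimage_algebra box B)
    qed
    have 1: "prob ?a = (\<Prod>j\<in>J. prob (X j -` A j \<inter> space M))"
      using J A by (intro indep_varsD[OF X_indep]) auto
    have 2: "prob ?b = (\<Prod>j\<in>J. prob (\<epsilon> j -` B j \<inter> space M))"
      using J B by (intro indep_varsD[OF \<epsilon>_indep]) auto
    \<comment> \<open>The same with cylinders that restrict coordinate \<open>j\<close>
      only.\<close>
    have single: "prob (a j) = prob (X j -` A j \<inter> space M) * prob (\<epsilon> j -` B j \<inter> space M)" if j: "j \<in> J" for j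
    proof -
      have "{f. \<forall>i\<in>J. f i \<in> (if i = j then A j else UNIV)} \<in> sets (Pi\<^sub>M UNIV (\<lambda>_. borel))"
        using A[OF j] by (intro box) auto
      from in_vimage_algebra[OF this, of "\<lambda>\<omega> i. X i \<omega>" "space M"]
      have "X j -` A j \<inter> space M \<in> sets (vimage_algebra (space M) (\<lambda>\<omega> i. X i \<omega>) (Pi\<^sub>M UNIV (\<lambda>_. borel)))"
        using j by (auto elim!: back_subst[of "\<lambda>x. x \<in> _"])
      moreover
      have "{f. \<forall>i\<in>J. f i \<in> (if i = j then B j else UNIV)} \<in> sets (Pi\<^sub>M UNIV (\<lambda>_. borel))"
        using B[OF j] by (intro box) auto
      from in_vimage_algebra[OF this, of "\<lambda>\<omega> i. \<epsilon> i \<omega>" "space M"]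
      have "\<epsilon> j -` B j \<inter> space M \<in> sets (vimage_algebra (space M) (\<lambda>\<omega> i. \<epsilon> i \<omega>) (Pi\<^sub>M UNIV (\<lambda>_. borel)))"
        using j by (auto elim!: back_subst[of "\<lambda>x. x \<in> _"])
      ultimately have "prob ((X j -` A j \<inter> space M) \<inter> (\<epsilon> j -` B j \<inter> space M)) =
          prob (X j -` A j \<inter> space M) * prob (\<epsilon> j -` B j \<inter> space M)"
        by (rule indep_setD[OF X_\<epsilon>_indep])
      also have "(X j -` A j \<inter> space M) \<inter> (\<epsilon> j -` B j \<inter> space M) = a j" using aAB[OF j] by auto
      finally show ?thesis .
    qed
    have "(\<Inter>j\<in>J. a j) = ?a \<inter> ?b" using aAB J by auto
    then have "prob (\<Inter>j\<in>J. a j) = prob ?a * prob ?b"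
      using indep_setD[OF X_\<epsilon>_indep a' b'] by simp
    also have "\<dots> = (\<Prod>j\<in>J. prob (a j))"
      unfolding 1 2 by (simp add: single prod.distrib)
    finally show "prob (\<Inter>j\<in>J. a j) = (\<Prod>j\<in>J. prob (a j))" .
  qed
  then have sig: "indep_sets (\<lambda>i. sigma_sets (space M) (E i)) UNIV"
    by (rule indep_sets_sigma) (rule stable)
  have E_Pow: "E i \<subseteq> Pow (space M)" for i by (auto simp: E_def)
  have Z_meas: "(\<lambda>\<omega>. (t \<bullet> X i \<omega>) * \<epsilon> i \<omega>) \<in> borel_measurable (sigma (space M) (E i))" for i
  proof -
    have [measurable]: "X i \<in> borel_measurable (sigma (space M) (E i))"
    proof (rule measurableI)
      fix A :: "(real^'p) set" assume "A \<in> sets borel"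
      then have "X i -` A \<inter> \<epsilon> i -` UNIV \<inter> space M \<in> E i" by (rule E_I) simp
      then show "X i -` A \<inter> space (sigma (space M) (E i)) \<in> sets (sigma (space M) (E i))"
        using E_Pow by (simp add: space_measure_of sigma_sets.Basic)
    qed simp
    have [measurable]: "\<epsilon> i \<in> borel_measurable (sigma (space M) (E i))"
    proof (rule measurableI)
      fix A :: "real set" assume "A \<in> sets borel"
      then have "X i -` UNIV \<inter> \<epsilon> i -` A \<inter> space M \<in> E i" by (intro E_I) simp_all
      then show "\<epsilon> i -` A \<inter> space (sigma (space M) (E i)) \<in> sets (sigma (space M) (E i))"
        using E_Pow by (simp add: space_measure_of sigma_sets.Basic)
    qed simp
    show ?thesis by measurable
  qed
  show ?thesis
    unfolding indep_vars_def2
  proof (intro conjI ballI)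
    show "indep_sets (\<lambda>i. {(\<lambda>\<omega>. (t \<bullet> X i \<omega>) * \<epsilon> i \<omega>) -` A \<inter> space M |A. A \<in> sets borel}) UNIV"
    proof (rule indep_sets_mono_sets[OF sig], safe)
      fix i and A :: "real set" assume "A \<in> sets borel"
      from measurable_sets[OF Z_meas[of i] this]
      show "(\<lambda>\<omega>. (t \<bullet> X i \<omega>) * \<epsilon> i \<omega>) -` A \<inter> space M \<in> sigma_sets (space M) (E i)"
        using E_Pow[of i] by (simp add: space_measure_of)
    qed
  qed measurable
qed

lemma score_centered: "expectation (\<lambda>\<omega>. (t \<bullet> X i \<omega>) * \<epsilon> i \<omega>) = 0"
  using indep_var_lebesgue_integral[OF X_\<epsilon>_inner_indep X_inner_integrable \<epsilon>_integrable]
  by (simp add: \<epsilon>_centered)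

text \<open>Squares of independent variables are independent, so the second moment of the product is
  the product of the second moments.\<close>

lemma
  shows score_square_integrable: "integrable M (\<lambda>\<omega>. ((t \<bullet> X i \<omega>) * \<epsilon> i \<omega>)\<^sup>2)"
    and score_variance: "expectation (\<lambda>\<omega>. ((t \<bullet> X i \<omega>) * \<epsilon> i \<omega>)\<^sup>2) = \<sigma>\<^sup>2 * (t \<bullet> (C *v t))"
proof -
  have "indep_var borel ((\<lambda>x::real. x\<^sup>2) \<circ> (\<lambda>\<omega>. t \<bullet> X i \<omega>)) borel ((\<lambda>x. x\<^sup>2) \<circ> \<epsilon> i)"
    by (rule indep_var_compose[OF X_\<epsilon>_inner_indep]) measurable
  then have ind: "indep_var borel (\<lambda>\<omega>. (t \<bullet> X i \<omega>)\<^sup>2) borel (\<lambda>\<omega>. (\<epsilon> i \<omega>)\<^sup>2)" by (simp add: comp_def)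
  show "integrable M (\<lambda>\<omega>. ((t \<bullet> X i \<omega>) * \<epsilon> i \<omega>)\<^sup>2)"
    using indep_var_integrable[OF ind X_inner_square_integrable \<epsilon>_square_integrable]
    by (simp add: power_mult_distrib)
  show "expectation (\<lambda>\<omega>. ((t \<bullet> X i \<omega>) * \<epsilon> i \<omega>)\<^sup>2) = \<sigma>\<^sup>2 * (t \<bullet> (C *v t))"
    using indep_var_lebesgue_integral[OF ind X_inner_square_integrable \<epsilon>_square_integrable]
    by (simp add: power_mult_distrib X_inner_variance \<epsilon>_second_moment)
qed

text \<open>By independence the law of the product is a function of the two marginal laws, and these
  do not vary with the index.\<close>

lemma score_ident:
  "distr M borel (\<lambda>\<omega>. (t \<bullet> X i \<omega>) * \<epsilon> i \<omega>) = distr M borel (\<lambda>\<omega>. (t \<bullet> X j \<omega>) * \<epsilon> j \<omega>)"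
proof -
  have inner: "distr M borel (\<lambda>\<omega>. t \<bullet> X i \<omega>) = distr (distr M borel (X i)) borel (\<lambda>x. t \<bullet> x)" for i
    by (subst distr_distr) (auto simp: comp_def)
  have prod: "distr M borel (\<lambda>\<omega>. (t \<bullet> X i \<omega>) * \<epsilon> i \<omega>) =
      distr (distr M borel (\<lambda>\<omega>. t \<bullet> X i \<omega>) \<Otimes>\<^sub>M distr M borel (\<epsilon> i)) borel (\<lambda>(x, y). x * y)" for i
    using X_\<epsilon>_inner_indep[of t i] unfolding indep_var_distribution_eq
    by (auto simp: distr_distr comp_def split_beta')
  show ?thesis
    unfolding prod[of i] prod[of j] inner X_ident[of i j] \<epsilon>_ident[of i j] ..
qed

text \<open>The Cramer-Wold reduction: \<open>t \<bullet> score\<close> is a normalized sum of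
  i.i.d. scalars of variance \<open>s\<^sup>2\<close>. The direction \<open>t = 0\<close> is
  separate because the scalar theorem needs a positive variance.\<close>

lemma score_char_tendsto:
  assumes C: "positive_definite C"
  shows "(\<lambda>n. CLINT \<omega>|M. iexp (t \<bullet> score n (\<lambda>i. X i \<omega>) (\<lambda>i. \<epsilon> i \<omega>)))
    \<longlonglongrightarrow> exp (- (t \<bullet> ((\<sigma>\<^sup>2 *\<^sub>R C) *v t)) / 2)"
proof (cases "t = 0")
  case True
  then show ?thesis by (simp add: prob_space)
next
  case False
  define s where "s = sqrt (\<sigma>\<^sup>2 * (t \<bullet> (C *v t)))"
  have "t \<bullet> (C *v t) > 0" using C False by (simp add: positive_definite_def)
  then have s: "s > 0" "s\<^sup>2 = \<sigma>\<^sup>2 * (t \<bullet> (C *v t))" using \<sigma>_pos by (simp_all add: s_def)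
  define Z where "Z i \<omega> = (t \<bullet> X i \<omega>) * \<epsilon> i \<omega>" for i \<omega>
  have [measurable]: "Z i \<in> borel_measurable M" for i unfolding Z_def by measurable
  have weak: "weak_conv_m (\<lambda>n. distr M borel (\<lambda>\<omega>. (\<Sum>i<n. Z i \<omega>) / sqrt (real n * s\<^sup>2))) std_normal_distribution"
  proof (rule central_limit_theorem_zero_mean)
    show "indep_vars (\<lambda>i. borel) Z UNIV" unfolding Z_def by (rule score_indep)
    show "expectation (Z n) = 0" for n unfolding Z_def by (rule score_centered)
    show "integrable M (\<lambda>x. (Z n x)\<^sup>2)" for n unfolding Z_def by (rule score_square_integrable)
    show "variance (Z n) = s\<^sup>2" for n
      unfolding s(2) Z_def score_centered using score_variance[of t n] by simp
    show "distr M borel (Z n) = distr M borel (Z 0)" for n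
      unfolding Z_def by (rule score_ident)
  qed (fact s(1))
  \<comment> \<open>Evaluation at \<open>s\<close> instead of 1 undoes the division by the standard
    deviation.\<close>
  have "(\<lambda>n. char (distr M borel (\<lambda>\<omega>. (\<Sum>i<n. Z i \<omega>) / sqrt (real n * s\<^sup>2))) s) \<longlonglongrightarrow> char std_normal_distribution s"
    by (rule levy_continuity1[OF _ real_dist_normal_dist weak]) (auto intro!: real_distribution_distr)
  moreover have "char (distr M borel (\<lambda>\<omega>. (\<Sum>i<n. Z i \<omega>) / sqrt (real n * s\<^sup>2))) s =
      (CLINT \<omega>|M. iexp (t \<bullet> score n (\<lambda>i. X i \<omega>) (\<lambda>i. \<epsilon> i \<omega>)))" for n
  proof -
    have "s * ((\<Sum>i<n. Z i \<omega>) / sqrt (real n * s\<^sup>2)) = t \<bullet> score n (\<lambda>i. X i \<omega>) (\<lambda>i. \<epsilon> i \<omega>)" for \<omega>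
      using s(1) by (simp add: score_def real_sqrt_mult Z_def inner_sum_right mult.commute)
    then show ?thesis
      unfolding char_def by (subst integral_distr) (auto simp flip: of_real_mult)
  qed
  moreover have "char std_normal_distribution s = exp (- (t \<bullet> ((\<sigma>\<^sup>2 *\<^sub>R C) *v t)) / 2)"
    by (simp add: char_std_normal_distribution s(2) scaleR_matrix_vector_assoc[symmetric])
  ultimately show ?thesis by simp
qed

text \<open>The weak law is applied to each of the finitely many entries. Events are supplied on
  which the bound holds for all \<open>u\<close> at once, so the set where it holds need not itself
  be shown measurable.\<close>

lemma gram_tendsto:
  assumes \<delta>: "\<delta> > 0"
  obtains E where "\<And>n. E n \<in> events" "(\<lambda>n. prob (E n)) \<longlonglongrightarrow> 1"
    "\<And>n \<omega> u. \<omega> \<in> E n \<Longrightarrow> norm (gram n (\<lambda>i. X i \<omega>) u - C *v u) \<le> \<delta> * norm u"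
proof -
  let ?p = "real CARD('p)"
  \<comment> \<open>An entrywise error of \<delta>' gives an operator norm of at most
    \<open>?p * ?p * \<delta>'\<close>.\<close>
  define \<delta>' where "\<delta>' = \<delta> / (?p * ?p)"
  have \<delta>': "\<delta>' > 0" "?p * ?p * \<delta>' = \<delta>" using \<delta> by (simp_all add: \<delta>'_def)
  define D where "D n \<omega> = (\<chi> j k. (\<Sum>i<n. X i \<omega> $ j * X i \<omega> $ k) / real n)" for n \<omega>
  define bad where "bad n j k = {\<omega>\<in>space M. \<delta>' \<le> \<bar>(\<Sum>i<n. X i \<omega> $ j * X i \<omega> $ k) / real n - C $ j $ k\<bar>}" for n j k
  have [measurable]: "bad n j k \<in> events" for n j k unfolding bad_def by measurable
  have bad0: "(\<lambda>n. prob (bad n j k)) \<longlonglongrightarrow> 0" for j k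
    unfolding bad_def X_nth_mult_expectation[of 0 j k, symmetric]
  proof (rule weak_law_of_large_numbers[where Z="\<lambda>i \<omega>. X i \<omega> $ j * X i \<omega> $ k"])
    show "indep_vars (\<lambda>_. borel) (\<lambda>i \<omega>. X i \<omega> $ j * X i \<omega> $ k) UNIV"
      by (rule indep_vars_compose2[OF X_indep]) measurable
    have "distr M borel (\<lambda>\<omega>. X i \<omega> $ j * X i \<omega> $ k) = distr (distr M borel (X i)) borel (\<lambda>x. x $ j * x $ k)" for i
      by (subst distr_distr) (auto simp: comp_def)
    then show "distr M borel (\<lambda>\<omega>. X a \<omega> $ j * X a \<omega> $ k) = distr M borel (\<lambda>\<omega>. X b \<omega> $ j * X b \<omega> $ k)" for a b
      using X_ident[of a b] by simp
  qed (fact X_nth_mult_integrable \<delta>'(1))+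
  define E where "E n = space M - (\<Union>j. \<Union>k. bad n j k)" for n
  show ?thesis
  proof
    show ev: "E n \<in> events" for n unfolding E_def by measurable
    show "(\<lambda>n. prob (E n)) \<longlonglongrightarrow> 1"
    proof (rule tendsto_sandwich[of "\<lambda>n. 1 - (\<Sum>j\<in>UNIV. \<Sum>k\<in>UNIV. prob (bad n j k))" _ _ "\<lambda>_. 1"])
      have "1 - (\<Sum>j\<in>UNIV. \<Sum>k\<in>UNIV. prob (bad n j k)) \<le> prob (E n)" for n
      proof -
        have "prob (\<Union>j. \<Union>k. bad n j k) \<le> (\<Sum>j\<in>UNIV. prob (\<Union>k. bad n j k))"
          by (rule measure_UNION_le) auto
        also have "\<dots> \<le> (\<Sum>j\<in>UNIV. \<Sum>k\<in>UNIV. prob (bad n j k))"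
          by (intro sum_mono measure_UNION_le) auto
        finally show ?thesis unfolding E_def by (subst prob_compl) auto
      qed
      then show "eventually (\<lambda>n. 1 - (\<Sum>j\<in>UNIV. \<Sum>k\<in>UNIV. prob (bad n j k)) \<le> prob (E n)) sequentially" by simp
      have "(\<lambda>n. 1 - (\<Sum>j\<in>UNIV. \<Sum>k\<in>UNIV. prob (bad n j k))) \<longlonglongrightarrow> 1 - (\<Sum>j\<in>(UNIV::'p set). \<Sum>k\<in>(UNIV::'p set). 0)"
        by (intro tendsto_intros bad0)
      then show "(\<lambda>n. 1 - (\<Sum>j\<in>UNIV. \<Sum>k\<in>UNIV. prob (bad n j k))) \<longlonglongrightarrow> 1" by simp
    qed auto
    fix n \<omega> u assume \<omega>: "\<omega> \<in> E n"
    have "\<bar>(D n \<omega> - C) $ j $ k\<bar> \<le> \<delta>'" for j k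
      using \<omega> by (auto simp: E_def bad_def D_def not_le less_imp_le)
    then have "onorm ((*v) (D n \<omega> - C)) \<le> ?p * ?p * \<delta>'"
      by (rule onorm_le_matrix_component)
    then have "norm ((D n \<omega> - C) *v u) \<le> \<delta> * norm u"
      using onorm[of "(*v) (D n \<omega> - C)" u] mult_right_mono[of "onorm ((*v) (D n \<omega> - C))" \<delta> "norm u"] \<delta>'(2)
      by (simp add: linear_linear)
    moreover have "D n \<omega> *v u = gram n (\<lambda>i. X i \<omega>) u"
      by (simp add: D_def gram_def vec_eq_iff matrix_vector_mult_def inner_vec_def sum_divide_distrib sum_distrib_right
          sum_distrib_left algebra_simps sum.swap[of _ "{..<n}"])
    ultimately show "norm (gram n (\<lambda>i. X i \<omega>) u - C *v u) \<le> \<delta> * norm u"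
      by (simp add: matrix_vector_mult_diff_rdistrib)
  qed
qed

end

section \<open>Convergence on convex sets\<close>

text \<open>The preimage of an open set under \<open>U\<close> is a preimage under \<open>W\<close>
  of a union of balls, with radii shrunk by \<open>c\<close>. Only values of \<open>W\<close> that
  occur are used, so no function of the noise has to be extended beyond the range of
  \<open>W\<close>.\<close>

lemma lipschitz_image_measurable:
  fixes U W :: "'b \<Rightarrow> 'a::euclidean_space"
  assumes W [measurable]: "W \<in> borel_measurable N" and c: "c > 0"
    and lip: "\<And>\<omega> \<omega>'. \<omega> \<in> space N \<Longrightarrow> \<omega>' \<in> space N \<Longrightarrow> c * dist (U \<omega>) (U \<omega>') \<le> dist (W \<omega>) (W \<omega>')"
  shows "U \<in> borel_measurable N"
proof (rule borel_measurableI)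
  fix S :: "'a set" assume "open S"
  define Q where "Q = (\<Union>(\<omega>, r)\<in>{(\<omega>, r). \<omega> \<in> space N \<and> ball (U \<omega>) r \<subseteq> S}. ball (W \<omega>) (c * r))"
  have "open Q" unfolding Q_def by (intro open_UN) auto
  have "U -` S \<inter> space N = W -` Q \<inter> space N"
  proof (intro set_eqI iffI)
    fix \<omega> assume \<omega>: "\<omega> \<in> U -` S \<inter> space N"
    then obtain r where "r > 0" "ball (U \<omega>) r \<subseteq> S"
      using \<open>open S\<close> by (auto simp: open_contains_ball)
    then show "\<omega> \<in> W -` Q \<inter> space N"
      using \<omega> c by (auto simp: Q_def intro!: exI[of _ \<omega>] exI[of _ r])
  next
    fix \<omega> assume \<omega>: "\<omega> \<in> W -` Q \<inter> space N"
    then obtain \<omega>' r where \<omega>': "\<omega>' \<in> space N" "ball (U \<omega>') r \<subseteq> S" "dist (W \<omega>') (W \<omega>) < c * r"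
      by (auto simp: Q_def)
    then have "c * dist (U \<omega>') (U \<omega>) < c * r" using lip[of \<omega>' \<omega>] \<omega> by auto
    then have "U \<omega> \<in> ball (U \<omega>') r" using c by simp
    then show "\<omega> \<in> U -` S \<inter> space N" using \<omega>' \<omega> by auto
  qed
  then show "U -` S \<inter> space N \<in> sets N" using \<open>open Q\<close> by (auto intro: measurable_sets_borel)
qed

lemma absolutely_continuous_frontier:
  fixes \<mu> :: "'a::euclidean_space measure"
  assumes "prob_space \<mu>" and sets: "sets \<mu> = sets borel" and ac: "absolutely_continuous lborel \<mu>"
    and neg: "negligible (frontier A)"
  shows "measure \<mu> (closure A) = measure \<mu> (interior A)"
proof -
  interpret prob_space \<mu> by fact
  have "frontier A \<in> null_sets lborel"
    using neg by (simp add: negligible_iff_null_sets null_sets_completion_iff)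
  then have "frontier A \<in> null_sets \<mu>"
    using ac by (auto simp: absolutely_continuous_def)
  moreover have "closure A = interior A \<union> frontier A"
    using interior_subset[of A] closure_subset[of A] by (auto simp: frontier_def)
  ultimately show ?thesis
    using sets measure_Un_null_set[of "interior A" \<mu> "frontier A"] by simp
qed

text \<open>If every stationary point for noise in the open set \<open>B\<close> lies in
  \<open>K\<close>, then \<open>K\<close> receives asymptotically at least the limit mass of
  \<open>B\<close>. Nothing is asked of the shape of \<open>K\<close>, so that complements are
  covered.\<close>

lemma (in linear_model) rescaled_minimizer_liminf:
  fixes v :: "'i \<Rightarrow> real^'p"
  assumes f: "max_linear_form f S v g" and G: "\<And>x. GDERIV g x :> G x" and Gc: "continuous_on UNIV G"
    and C: "positive_definite C"
    and bhat_minimizer: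
      "\<And>n \<omega>. \<omega> \<in> space M \<Longrightarrow>
        (\<exists>b. is_arg_min (penalized_ls n (\<lambda>i. X i \<omega> \<bullet> \<beta> + \<epsilon> i \<omega>) (\<lambda>i. X i \<omega>) (\<lambda>b. sqrt (real n) * f b))
               (\<lambda>_. True) b) \<Longrightarrow>
        is_arg_min (penalized_ls n (\<lambda>i. X i \<omega> \<bullet> \<beta> + \<epsilon> i \<omega>) (\<lambda>i. X i \<omega>) (\<lambda>b. sqrt (real n) * f b))
          (\<lambda>_. True) (bhat n \<omega>)"
    and N: "prob_space N" and W: "distributed N lborel W (mvnormal_density 0 (\<sigma>\<^sup>2 *\<^sub>R C))"
    and K: "\<And>n. {\<omega> \<in> space M. sqrt (real n) *\<^sub>R (bhat n \<omega> - \<beta>) \<in> K} \<in> events"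
    and B: "open B" "\<And>w u. w \<in> B \<Longrightarrow> optimal_at (pattern S v \<beta>) v C (G \<beta>) u w \<Longrightarrow> u \<in> K"
    and a: "a < measure (distr N lborel W) B"
  shows "eventually (\<lambda>n. a < prob {\<omega> \<in> space M. sqrt (real n) *\<^sub>R (bhat n \<omega> - \<beta>) \<in> K}) sequentially"
proof -
  interpret N: prob_space N by fact
  let ?\<mu> = "distr N lborel W"
  have Wm: "W \<in> measurable N lborel" using W by (simp add: distributed_def)
  have [measurable]: "W \<in> borel_measurable N" using Wm by simp
  have \<mu>: "prob_space ?\<mu>" "sets ?\<mu> = sets borel"
    using N.prob_space_distr[OF Wm] by simp_all
  interpret \<mu>: prob_space ?\<mu> by (rule \<mu>(1))
  define wn where "wn n \<omega> = score n (\<lambda>i. X i \<omega>) (\<lambda>i. \<epsilon> i \<omega>)" for n \<omega>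
  have [measurable]: "wn n \<in> borel_measurable M" for n unfolding wn_def score_def by measurable
  have CA: "positive_definite (\<sigma>\<^sup>2 *\<^sub>R C)"
    using C \<sigma>_pos by (auto simp: positive_definite_def scaleR_matrix_vector_assoc[symmetric] transpose_scalar)
  \<comment> \<open>The margin is spent on the neighbourhood \<open>A\<close> of \<open>K0\<close>,
    to which the limit theorem is applied, and on the distance from the score to \<open>w'\<close>.
    Compactness of \<open>K0\<close> makes \<open>A\<close> bounded, which supplies the bound
    \<open>R\<close> on the score.\<close>
  obtain K0 \<eta> where K0: "compact K0" "a < measure ?\<mu> K0" and \<eta>: "\<eta> > 0"
    "\<And>x y. x \<in> K0 \<Longrightarrow> dist x y < 2 * \<eta> \<Longrightarrow> y \<in> B"
    using open_prob_inner_thickening[OF \<mu> B(1) a] by metis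
  define A where "A = (\<Union>x\<in>K0. ball x \<eta>)"
  have "open A" unfolding A_def by (intro open_UN ballI open_ball)
  have "bounded A"
  proof -
    obtain R where R: "\<And>x. x \<in> K0 \<Longrightarrow> norm x \<le> R"
      using compact_imp_bounded[OF K0(1)] by (auto simp: bounded_iff)
    have "norm y \<le> R + \<eta>" if yA: "y \<in> A" for y
    proof -
      obtain x where x: "x \<in> K0" "dist x y < \<eta>" using yA by (auto simp: A_def)
      have "norm y \<le> norm x + norm (y - x)" using norm_triangle_ineq[of x "y - x"] by simp
      then show ?thesis using R[OF x(1)] x(2) by (simp add: dist_norm norm_minus_commute)
    qed
    then show ?thesis by (auto simp: bounded_iff)
  qed
  then obtain R where R: "\<And>w. w \<in> A \<Longrightarrow> norm w \<le> R" by (auto simp: bounded_iff)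
  \<comment> \<open>The midpoint leaves \<open>a' - a\<close> to be given up to the complement of
    \<open>E n\<close>.\<close>
  define a' where "a' = (a + measure ?\<mu> K0) / 2"
  have a': "a < a'" "a' < measure ?\<mu> A"
  proof -
    have "measure ?\<mu> K0 \<le> measure ?\<mu> A"
      using \<open>open A\<close> \<eta>(1) by (intro \<mu>.finite_measure_mono) (auto simp: A_def)
    then show "a < a'" "a' < measure ?\<mu> A" using K0(2) by (simp_all add: a'_def)
  qed
  obtain \<delta> n0 where \<delta>: "\<delta> > 0" and n0: "n0 > (0::nat)" and near:
    "\<forall>n\<ge>n0. \<forall>x e. (\<forall>u. norm (gram n x u - C *v u) \<le> \<delta> * norm u) \<longrightarrow> norm (score n x e) \<le> R \<longrightarrow>
      (\<exists>b. is_arg_min (penalized_ls n (\<lambda>i. x i \<bullet> \<beta> + e i) x (\<lambda>b. sqrt (real n) * f b)) (\<lambda>_. True) b) \<and>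
      (\<forall>b. is_arg_min (penalized_ls n (\<lambda>i. x i \<bullet> \<beta> + e i) x (\<lambda>b. sqrt (real n) * f b)) (\<lambda>_. True) b \<longrightarrow>
        (\<exists>w'. norm (w' - score n x e) \<le> \<eta> \<and>
          optimal_at (pattern S v \<beta>) v C (G \<beta>) (sqrt (real n) *\<^sub>R (b - \<beta>)) w'))"
    by (rule penalized_ls_near_optimal[OF f G Gc C \<eta>(1), of R \<beta>])
  obtain E where E: "\<And>n. E n \<in> events" "(\<lambda>n. prob (E n)) \<longlonglongrightarrow> 1"
    "\<And>n \<omega> u. \<omega> \<in> E n \<Longrightarrow> norm (gram n (\<lambda>i. X i \<omega>) u - C *v u) \<le> \<delta> * norm u"
    using gram_tendsto[OF \<delta>] by metis
  have "eventually (\<lambda>n. a' < measure (distr M borel (wn n)) A) sequentially"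
  proof (rule char_tendsto_imp_open_liminf[OF _ _ \<mu> _ \<open>open A\<close> a'(2)])
    show "(\<lambda>n. CLINT w|distr M borel (wn n). iexp (t \<bullet> w)) \<longlonglongrightarrow> (CLINT w|?\<mu>. iexp (t \<bullet> w))" for t
    proof -
      have "(CLINT w|?\<mu>. iexp (t \<bullet> w)) = exp (- (t \<bullet> ((\<sigma>\<^sup>2 *\<^sub>R C) *v t)) / 2)"
        using char_mvnormal[OF N W CA, of t] Wm by (subst integral_distr) auto
      moreover have "(CLINT w|distr M borel (wn n). iexp (t \<bullet> w)) = (CLINT \<omega>|M. iexp (t \<bullet> wn n \<omega>))" for n
        by (subst integral_distr) auto
      ultimately show ?thesis
        using score_char_tendsto[OF C, of t] unfolding wn_def by simp
    qed
  qed (auto intro!: prob_space_distr)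
  moreover have "eventually (\<lambda>n. 1 - (a' - a) < prob (E n)) sequentially"
    by (rule order_tendstoD(1)[OF E(2)]) (use a' in simp)
  ultimately show ?thesis
    using eventually_ge_at_top[of n0]
  proof eventually_elim
    case (elim n)
    let ?A = "wn n -` A \<inter> space M"
    have A_ev: "?A \<in> events" using \<open>open A\<close> by (intro measurable_sets[of _ _ borel]) auto
    have pA: "a' < prob ?A" using elim(1) \<open>open A\<close> by (simp add: measure_distr)
    have "?A \<inter> E n \<subseteq> {\<omega> \<in> space M. sqrt (real n) *\<^sub>R (bhat n \<omega> - \<beta>) \<in> K}"
    proof
      fix \<omega> assume \<omega>: "\<omega> \<in> ?A \<inter> E n"
      then have wA: "wn n \<omega> \<in> A" and sp: "\<omega> \<in> space M" by auto
      have nr: "(\<exists>b. is_arg_min (penalized_ls n (\<lambda>i. X i \<omega> \<bullet> \<beta> + \<epsilon> i \<omega>) (\<lambda>i. X i \<omega>) (\<lambda>b. sqrt (real n) * f b)) (\<lambda>_. True) b) \<and>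
        (\<forall>b. is_arg_min (penalized_ls n (\<lambda>i. X i \<omega> \<bullet> \<beta> + \<epsilon> i \<omega>) (\<lambda>i. X i \<omega>) (\<lambda>b. sqrt (real n) * f b)) (\<lambda>_. True) b \<longrightarrow>
        (\<exists>w'. norm (w' - wn n \<omega>) \<le> \<eta> \<and>
          optimal_at (pattern S v \<beta>) v C (G \<beta>) (sqrt (real n) *\<^sub>R (b - \<beta>)) w'))"
        using near elim(3) \<omega> E(3) R[OF wA] unfolding wn_def by simp
      then obtain w' where w': "norm (w' - wn n \<omega>) \<le> \<eta>"
        "optimal_at (pattern S v \<beta>) v C (G \<beta>) (sqrt (real n) *\<^sub>R (bhat n \<omega> - \<beta>)) w'"
        using bhat_minimizer[OF sp] by blast
      obtain x where x: "x \<in> K0" "dist x (wn n \<omega>) < \<eta>" using wA by (auto simp: A_def)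
      have "dist x w' < 2 * \<eta>"
        using dist_triangle[of x w' "wn n \<omega>"] x(2) w'(1) by (simp add: dist_norm norm_minus_commute)
      then have "w' \<in> B" using \<eta>(2) x(1) by blast
      then show "\<omega> \<in> {\<omega> \<in> space M. sqrt (real n) *\<^sub>R (bhat n \<omega> - \<beta>) \<in> K}"
        using B(2) w'(2) sp by blast
    qed
    then have "prob (?A \<inter> E n) \<le> prob {\<omega> \<in> space M. sqrt (real n) *\<^sub>R (bhat n \<omega> - \<beta>) \<in> K}"
      by (intro finite_measure_mono K)
    moreover have "prob ?A \<le> prob (?A \<inter> E n) + prob (space M - E n)"
    proof -
      have "prob ?A \<le> prob ((?A \<inter> E n) \<union> (space M - E n))"
        using A_ev E(1) by (intro finite_measure_mono) auto
      also have "\<dots> \<le> prob (?A \<inter> E n) + prob (space M - E n)"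
        using A_ev E(1) by (intro measure_Un_le) auto
      finally show ?thesis .
    qed
    moreover have "prob (space M - E n) = 1 - prob (E n)" by (rule prob_compl[OF E(1)])
    ultimately show ?case using pA elim(2) by linarith
  qed
qed

theorem theorem3p3:
  fixes M :: "'a measure"
    and X :: "nat \<Rightarrow> 'a \<Rightarrow> real^'p"
    and \<epsilon> :: "nat \<Rightarrow> 'a \<Rightarrow> real"
    and C :: "real^'p^'p"
    and \<sigma> :: real
    and \<beta>0 :: "real^'p"
    and y :: "nat \<Rightarrow> 'a \<Rightarrow> real"
    and f g :: "real^'p \<Rightarrow> real"
    and S :: "'i set"
    and v :: "'i \<Rightarrow> real^'p"
    and bhat uhat :: "nat \<Rightarrow> 'a \<Rightarrow> real^'p"
    and N :: "'b measure"
    and W U :: "'b \<Rightarrow> real^'p"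
  assumes model: "linear_model M X \<epsilon> C \<sigma>"
    and y: "\<And>i \<omega>. y i \<omega> = X i \<omega> \<bullet> \<beta>0 + \<epsilon> i \<omega>"
    and C: "positive_definite C"
    and f: "max_linear_form f S v g"
    and bhat_measurable: "\<And>n. bhat n \<in> borel_measurable M"
    and bhat_minimizer:
      "\<And>n \<omega>. \<omega> \<in> space M \<Longrightarrow>
        (\<exists>b. is_arg_min (penalized_ls n (\<lambda>i. y i \<omega>) (\<lambda>i. X i \<omega>) (\<lambda>b. sqrt (real n) * f b))
               (\<lambda>_. True) b) \<Longrightarrow>
        is_arg_min (penalized_ls n (\<lambda>i. y i \<omega>) (\<lambda>i. X i \<omega>) (\<lambda>b. sqrt (real n) * f b))
          (\<lambda>_. True) (bhat n \<omega>)"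
    and uhat: "\<And>n \<omega>. uhat n \<omega> = sqrt (real n) *\<^sub>R (bhat n \<omega> - \<beta>0)"
    and N: "prob_space N"
    and W: "distributed N lborel W (mvnormal_density 0 (\<sigma>\<^sup>2 *\<^sub>R C))"
    and U: "\<And>\<omega>. \<omega> \<in> space N \<Longrightarrow>
        is_arg_min (\<lambda>u. u \<bullet> (C *v u) / 2 - u \<bullet> W \<omega> + dir_deriv f \<beta>0 u) (\<lambda>_. True) (U \<omega>)"
  shows
    "(\<forall>K. convex K \<and>
          (\<forall>n. {\<omega> \<in> space M. uhat n \<omega> \<in> K} \<in> sets M) \<and> {\<omega> \<in> space N. U \<omega> \<in> K} \<in> sets N \<longrightarrow>
        (\<lambda>n. measure M {\<omega> \<in> space M. uhat n \<omega> \<in> K})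
          \<longlonglongrightarrow> measure N {\<omega> \<in> space N. U \<omega> \<in> K}) \<and>
     (\<forall>f' (S' :: 'j set) v' g'. max_linear_form f' S' v' g' \<longrightarrow>
        (\<forall>\<pp>\<in>patterns S' v'.
          (\<lambda>n. measure M {\<omega> \<in> space M. pattern S' v' (uhat n \<omega>) = \<pp>})
            \<longlonglongrightarrow> measure N {\<omega> \<in> space N. pattern S' v' (U \<omega>) = \<pp>}))"
proof -
  interpret linear_model M X \<epsilon> C \<sigma> by (rule model)
  interpret N: prob_space N by (rule N)
  obtain G where G: "\<And>x. GDERIV g x :> G x" and Gc: "continuous_on UNIV G"
    using f by (auto simp: max_linear_form_def)
  let ?P = "pattern S v \<beta>0"
  let ?opt = "optimal_at ?P v C (G \<beta>0)"
  have P: "finite ?P" "?P \<noteq> {}"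
    using f by (auto simp: max_linear_form_def finite_pattern pattern_nonempty)
  obtain c where c: "c > 0" "\<And>x. c * (norm x)\<^sup>2 \<le> x \<bullet> (C *v x)"
    using positive_definite_coercive[OF C] by blast
  note lip = optimal_at_lipschitz[OF P c]
  have optU: "?opt (U \<omega>) (W \<omega>)" if "\<omega> \<in> space N" for \<omega>
    by (rule limit_minimizer_optimal[OF f G C U[OF that]])
  have unique: "u = u'" if "?opt u w" "?opt u' w" for u u' w
    using lip[OF that] c(1) by (simp add: mult_le_0_iff)
  have Wm: "W \<in> measurable N lborel" using W by (simp add: distributed_def)
  then have W_borel [measurable]: "W \<in> borel_measurable N" by simp
  let ?\<mu> = "distr N lborel W"
  have \<mu>: "prob_space ?\<mu>" "sets ?\<mu> = sets borel"
    using N.prob_space_distr[OF Wm] by simp_all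
  interpret \<mu>: prob_space ?\<mu> by (rule \<mu>(1))
  have ac: "absolutely_continuous lborel ?\<mu>"
    using W by (auto simp: distributed_def intro!: absolutely_continuousI_density)
  \<comment> \<open>Minimality is known pointwise only; the Lipschitz dependence on the noise makes
    \<open>U\<close> a random vector.\<close>
  have U_meas [measurable]: "U \<in> borel_measurable N"
    by (rule lipschitz_image_measurable[OF W_borel c(1)]) (simp add: dist_norm lip[OF optU optU])
  have uhat_meas [measurable]: "uhat n \<in> borel_measurable M" for n
    unfolding uhat using bhat_measurable[of n] by measurable

  have conv: "(\<lambda>n. prob {\<omega> \<in> space M. uhat n \<omega> \<in> K}) \<longlonglongrightarrow> measure N {\<omega> \<in> space N. U \<omega> \<in> K}"
    if K: "convex K" and K_meas: "\<And>n. {\<omega> \<in> space M. uhat n \<omega> \<in> K} \<in> events"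
      and KU: "{\<omega> \<in> space N. U \<omega> \<in> K} \<in> sets N" for K
  proof -
    define A where "A = {w. \<exists>u\<in>K. ?opt u w}"
    have UA: "U \<omega> \<in> K \<longleftrightarrow> W \<omega> \<in> A" if "\<omega> \<in> space N" for \<omega>
      using optU[OF that] unique unfolding A_def by blast
    have eq: "measure ?\<mu> (closure A) = measure ?\<mu> (interior A)"
      unfolding A_def by (intro absolutely_continuous_frontier[OF \<mu> ac] negligible_frontier_optimal_at P K)
    have meas_\<mu>: "measure ?\<mu> Q = measure N {\<omega> \<in> space N. W \<omega> \<in> Q}" if "Q \<in> sets borel" for Q
      using that Wm by (subst measure_distr) (auto intro: arg_cong[where f="measure N"])
    \<comment> \<open>\<open>A\<close> need not be Borel, so the event is caught between the
      interior and the closure, which have equal mass.\<close>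
    have lower: "measure ?\<mu> (interior A) \<le> measure N {\<omega> \<in> space N. U \<omega> \<in> K}"
      using interior_subset[of A] UA KU by (subst meas_\<mu>) (auto intro!: N.finite_measure_mono)
    have [measurable]: "closure A \<in> sets borel" by simp
    have "{\<omega> \<in> space N. W \<omega> \<in> closure A} \<in> sets N" by measurable
    then have upper: "measure N {\<omega> \<in> space N. U \<omega> \<in> K} \<le> measure ?\<mu> (closure A)"
      using closure_subset[of A] UA by (subst meas_\<mu>) (auto intro!: N.finite_measure_mono)
    have val: "measure ?\<mu> (interior A) = measure N {\<omega> \<in> space N. U \<omega> \<in> K}"
      using lower upper eq by simp
    have compl: "measure ?\<mu> (- closure A) = 1 - measure N {\<omega> \<in> space N. U \<omega> \<in> K}"
      using \<mu>.prob_compl[of "closure A"] val eq by (simp add: Compl_eq_Diff_UNIV)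
    note lim = rescaled_minimizer_liminf[OF f G Gc C bhat_minimizer[unfolded y] N W, folded uhat]
    show ?thesis
    proof (rule order_tendstoI)
      fix a assume "a < measure N {\<omega> \<in> space N. U \<omega> \<in> K}"
      then have a: "a < measure ?\<mu> (interior A)" using val by simp
      show "eventually (\<lambda>n. a < prob {\<omega> \<in> space M. uhat n \<omega> \<in> K}) sequentially"
      proof (rule lim[OF _ _ K_meas open_interior _ a])
        fix w u assume "w \<in> interior A" "?opt u w"
        then show "u \<in> K" using interior_subset[of A] unique unfolding A_def by blast
      qed
    next
      fix a assume "measure N {\<omega> \<in> space N. U \<omega> \<in> K} < a"
      then have a: "1 - a < measure ?\<mu> (- closure A)" using compl by simp
      have compl_eq: "{\<omega> \<in> space M. uhat n \<omega> \<in> - K} = space M - {\<omega> \<in> space M. uhat n \<omega> \<in> K}" for n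
        by auto
      \<comment> \<open>The upper bound is the lower bound for \<open>- K\<close>: noise outside
        \<open>closure A\<close> admits no stationary point in \<open>K\<close>.\<close>
      have "eventually (\<lambda>n. 1 - a < prob {\<omega> \<in> space M. uhat n \<omega> \<in> - K}) sequentially"
      proof (rule lim[OF _ _ _ _ _ a])
        show "{\<omega> \<in> space M. uhat n \<omega> \<in> - K} \<in> events" for n
          unfolding compl_eq using K_meas by auto
        show "u \<in> - K" if "w \<in> - closure A" "?opt u w" for w u
          using that closure_subset[of A] unfolding A_def by blast
      qed auto
      then show "eventually (\<lambda>n. prob {\<omega> \<in> space M. uhat n \<omega> \<in> K} < a) sequentially"
        unfolding compl_eq prob_compl[OF K_meas] by simp
    qed
  qed
  show ?thesis
  proof (intro conjI allI impI ballI)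
    fix K assume "convex K \<and> (\<forall>n. {\<omega> \<in> space M. uhat n \<omega> \<in> K} \<in> sets M) \<and> {\<omega> \<in> space N. U \<omega> \<in> K} \<in> sets N"
    then show "(\<lambda>n. prob {\<omega> \<in> space M. uhat n \<omega> \<in> K}) \<longlonglongrightarrow> measure N {\<omega> \<in> space N. U \<omega> \<in> K}"
      by (intro conv) auto
  next
    fix f' g' and S' :: "'j set" and v' :: "'j \<Rightarrow> real^'p" and \<pp>
    assume "max_linear_form f' S' v' g'"
    then have S': "finite S'" "S' \<noteq> {}" by (auto simp: max_linear_form_def)
    let ?K = "{x. pattern S' v' x = \<pp>}"
    \<comment> \<open>Cells are Borel, so the measurability conditions attached to convex sets hold
      for them automatically.\<close>
    have [measurable]: "?K \<in> sets borel" by (rule borel_pattern_cell[OF S'(1)])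
    have "{\<omega> \<in> space M. uhat n \<omega> \<in> ?K} \<in> events" for n by measurable
    moreover have "{\<omega> \<in> space N. U \<omega> \<in> ?K} \<in> sets N" by measurable
    ultimately show "(\<lambda>n. prob {\<omega> \<in> space M. pattern S' v' (uhat n \<omega>) = \<pp>})
        \<longlonglongrightarrow> measure N {\<omega> \<in> space N. pattern S' v' (U \<omega>) = \<pp>}"
      using conv[OF convex_pattern_cell[OF S']] by simp
  qed
qed

end
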